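(* Let $\mathcal{H}$ be a real Hilbert space, $S\in\mathcal{P}(\mathcal{H})$, $L_D\ge 0$ and $\beta_E\ge0$. Assume that $B:\mathcal{H}\to2^{\mathcal{H}}$, that $D:\mathcal{H}\to\mathcal{H}$ is $L_D$-Lipschitz continuous w.r.t. $\|\cdot\|$, that $E:\mathcal{H}\to\mathcal{H}$ is $\frac1{\beta_E}$-cocoercive w.r.t. $\|\cdot\|$, that $K:\mathcal{H}\to\mathcal{H}$ is linear skew-adjoint, that $B+D$ is maximally monotone, and that $\mathrm{zer}(B+D+E+K):=\{x:0\in Bx+Dx+Ex+Kx\}\ne\emptyset$. Suppose that for all $k\in\mathbb{N}$, $\theta_k\in[\epsilon_\theta,2-\epsilon_\theta]$ for some $\epsilon_\theta\in(0,1)$, and that $\gamma_k\in[\epsilon,\frac1\epsilon]$ and $\gamma_k\le\frac{4-\epsilon}{\beta_E+4L_D}$ for some $\epsilon\in(0,1)$ ($\epsilon_\theta,\epsilon$ independent of $k$). Put $M_k:=\gamma_k^{-1}\mathrm{Id}-D-K$, let $x_0\in\mathcal{H}$ and, for $k=0,1,\ldots$, let $$\hat x_k:=(\mathrm{Id}+\gamma_kB)^{-1}(\mathrm{Id}-\gamma_k(D+K+E))x_k,$$ $$\mu_k:=\frac{\langle M_kx_k-M_k\hat x_k,x_k-\hat x_k\rangle-\frac{\beta_E}{4}\|x_k-\hat x_k\|^2}{\|M_kx_k-M_k\hat x_k\|_{S^{-1}}^2},$$ $$x_{k+1}:=x_k-\theta_k\mu_kS^{-1}(M_kx_k-M_k\hat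 x_k).$$ Then $(x_k)_{k\in\mathbb{N}}$ converges weakly to some $\bar x\in\mathrm{zer}(B+D+E+K)$. Moreover, if $B+D+E+K$ is metrically subregular at all $z\in\mathrm{zer}(B+D+E+K)$ for $0$ and $\mathcal{H}$ is finite-dimensional, then $x_k\to\bar x\in\mathrm{zer}(B+D+E+K)$ locally R-linearly and $\mathrm{dist}_S(x_k,\mathrm{zer}(B+D+E+K))$ converges locally Q-linearly to zero.
   Context: $\mathcal{P}(\mathcal{H})$ is the set of bounded linear self-adjoint positive definite operators on $\mathcal{H}$ (positive definite in the sense that there are $0<\lambda_{\min}(S)\le\lambda_{\max}(S)<\infty$ with $\lambda_{\min}(S)\|x\|^2\le\langle x,Sx\rangle\le\lambda_{\max}(S)\|x\|^2$ for all $x$); $\|x\|_S=\sqrt{\langle x,Sx\rangle}$. $E$ is $\frac1{\beta_E}$-cocoercive w.r.t. $\|\cdot\|$ if $\langle Ex-Ey,x-y\rangle\ge\frac1{\beta_E}\|Ex-Ey\|^2$ for all $x,y$; for $\beta_E=0$ this means that $E$ is constant. Linear skew-adjoint means bounded, linear, with $K^*=-K$. Conventions: $\frac00=0$ (relevant for $\mu_k$ when $\hat x_k=x_k$) and $\frac{\alpha}{0}=\infty$ for $\alpha>0$ (so the bound $\gamma_k\le\frac{4-\epsilon}{\beta_E+4L_D}$ is void if $\beta_E=L_D=0$). $\mathrm{dist}_S(x,H)=\inf_{y\in H}\|x-y\|_S$ ($+\infty$ if $H=\emptyset$). Metric subregularity: $F:\mathcal{H}\to2^{\mathcal{H}}$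 is metrically subregular at $\bar x$ for $\bar y$ if $\bar y\in F\bar x$ and there exist $\kappa\in[0,\infty)$ and neighborhoods $\mathcal{U}$ of $\bar x$ and $\mathcal{V}$ of $\bar y$ such that $\mathrm{dist}_S(x,F^{-1}\bar y)\le\kappa\,\mathrm{dist}_S(\bar y,Fx\cap\mathcal{V})$ for all $x\in\mathcal{U}$. A nonnegative sequence $(d_k)$ converges locally Q-linearly to zero if there are $K_0\in\mathbb{N}$ and $c\in[0,1)$ with $d_{k+1}\le c\,d_k$ for all $k\ge K_0$; $x_k\to\bar x$ locally R-linearly if there are $K_0\in\mathbb{N}$, $R\ge0$ and $c\in[0,1)$ with $\|x_k-\bar x\|_S\le Rc^k$ for all $k\ge K_0$. *)

theory Defs
  imports "HOL-Analysis.Analysis"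
begin

text \<open>
  A set-valued operator on \<open>'a\<close> is a function of type \<open>'a \<Rightarrow> 'a set\<close>. Sums of operators are
  pointwise Minkowski sums; a single-valued map \<open>D\<close> enters such a sum as \<open>\<lambda>x. {D x}\<close>.
\<close>

definition op_graph :: "('a \<Rightarrow> 'a set) \<Rightarrow> ('a \<times> 'a) set" where
  "op_graph A = {(x, u). u \<in> A x}"

definition op_inverse :: "('a \<Rightarrow> 'a set) \<Rightarrow> 'a \<Rightarrow> 'a set" where
  "op_inverse A u = {x. u \<in> A x}"

definition zer :: "('a::zero \<Rightarrow> 'a set) \<Rightarrow> 'a set" where
  "zer A = {x. 0 \<in> A x}"

definition monotone_op :: "('a::real_inner \<Rightarrow> 'a set) \<Rightarrow> bool" where
  "monotone_op A \<longleftrightarrow> (\<forall>x y. \<forall>u\<in>A x. \<forall>v\<in>A y. 0 \<le> inner (u - v) (x - y))"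

definition maximally_monotone :: "('a::real_inner \<Rightarrow> 'a set) \<Rightarrow> bool" where
  "maximally_monotone A \<longleftrightarrow>
     monotone_op A \<and> (\<forall>A'. monotone_op A' \<and> op_graph A \<subseteq> op_graph A' \<longrightarrow> op_graph A' = op_graph A)"

text \<open>
  The library's \<^const>\<open>adjoint\<close> is a choice of some adjoint; bounded linear operators on a Hilbert
  space have exactly one.
\<close>

definition pos_def_op :: "('a::real_inner \<Rightarrow> 'a) \<Rightarrow> bool" where
  "pos_def_op S \<longleftrightarrow> bounded_linear S \<and> adjoint S = S \<and>
     (\<exists>l u. 0 < l \<and> l \<le> u \<and>
        (\<forall>x. l * (norm x)\<^sup>2 \<le> inner x (S x) \<and> inner x (S x) \<le> u * (norm x)\<^sup>2))"

definition linear_skew_adjoint :: "('a::real_inner \<Rightarrow> 'a) \<Rightarrow> bool" where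
  "linear_skew_adjoint K \<longleftrightarrow> bounded_linear K \<and> adjoint K = (\<lambda>x. - K x)"

definition norm_wrt :: "('a::real_inner \<Rightarrow> 'a) \<Rightarrow> 'a \<Rightarrow> real" where
  "norm_wrt S x = sqrt (inner x (S x))"

text \<open>The value for the empty set is \<open>\<infinity>\<close>.\<close>

definition dist_wrt :: "('a::real_inner \<Rightarrow> 'a) \<Rightarrow> 'a \<Rightarrow> 'a set \<Rightarrow> ennreal" where
  "dist_wrt S x H = (INF y\<in>H. ennreal (norm_wrt S (x - y)))"

text \<open>
  The parameter is the reciprocal of the cocoercivity constant: \<open>E\<close> is \<open>1 / \<beta>\<close>-cocoercive, which
  for \<open>\<beta> = 0\<close> is read as constancy.
\<close>

definition recip_cocoercive :: "real \<Rightarrow> ('a::real_inner \<Rightarrow> 'a) \<Rightarrow> bool" where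
  "recip_cocoercive \<beta> E \<longleftrightarrow>
     (if \<beta> = 0 then (\<exists>c. \<forall>x. E x = c)
      else (\<forall>x y. inner (E x - E y) (x - y) \<ge> 1 / \<beta> * (norm (E x - E y))\<^sup>2))"

text \<open>
  A neighborhood of a point is a set with that point in its interior. In \<^typ>\<open>ennreal\<close> we have
  \<open>0 * \<infinity> = 0\<close>; this is harmless below, as \<open>\<kappa>\<close> can be enlarged.
\<close>

definition metrically_subregular ::
  "('a::real_inner \<Rightarrow> 'a) \<Rightarrow> ('a \<Rightarrow> 'a set) \<Rightarrow> 'a \<Rightarrow> 'a \<Rightarrow> bool" where
  "metrically_subregular S F xb yb \<longleftrightarrow> yb \<in> F xb \<and>
     (\<exists>\<kappa>::real. \<exists>U V. 0 \<le> \<kappa> \<and> xb \<in> interior U \<and> yb \<in> interior V \<and>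
        (\<forall>x\<in>U. dist_wrt S x (op_inverse F yb) \<le> ennreal \<kappa> * dist_wrt S yb (F x \<inter> V)))"

definition weakly_converges :: "(nat \<Rightarrow> 'a::real_inner) \<Rightarrow> 'a \<Rightarrow> bool" where
  "weakly_converges x xb \<longleftrightarrow> (\<forall>y. (\<lambda>k. inner (x k) y) \<longlonglongrightarrow> inner xb y)"

definition locally_Q_linear_to_zero :: "(nat \<Rightarrow> ennreal) \<Rightarrow> bool" where
  "locally_Q_linear_to_zero d \<longleftrightarrow>
     (\<exists>K0. \<exists>c::real. 0 \<le> c \<and> c < 1 \<and> (\<forall>k\<ge>K0. d (Suc k) \<le> ennreal c * d k))"

definition locally_R_linear :: "('a::real_inner \<Rightarrow> 'a) \<Rightarrow> (nat \<Rightarrow> 'a) \<Rightarrow> 'a \<Rightarrow> bool" where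
  "locally_R_linear S x xb \<longleftrightarrow>
     (\<exists>K0. \<exists>R c::real. 0 \<le> R \<and> 0 \<le> c \<and> c < 1 \<and> (\<forall>k\<ge>K0. norm_wrt S (x k - xb) \<le> R * c ^ k))"

end

theory Submission
  imports Defs
begin

text \<open>
  Write \<open>w\<^sub>k = M\<^sub>k x\<^sub>k - M\<^sub>k xhat\<^sub>k\<close> and \<open>d\<^sub>k = x\<^sub>k - xhat\<^sub>k\<close>. Monotonicity of \<open>B + D\<close>, skewness of
  \<open>K\<close> and cocoercivity of \<open>E\<close> show that every zero \<open>z\<close> lies in the half-space
  \<open>inner w\<^sub>k (x\<^sub>k - z) \<ge> inner w\<^sub>k d\<^sub>k - \<beta>\<^sub>E / 4 * norm d\<^sub>k ^ 2\<close>, whose right-hand side is at least a fixed multiple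
  of \<open>norm d\<^sub>k ^ 2\<close> by the step-size bound. The iteration is a relaxed projection, in the metric of \<open>S\<close>,
  onto this half-space, so the squared \<open>S\<close>-distance to each zero drops by at least \<open>q * norm d\<^sub>k ^ 2\<close>.
  Hence \<open>d\<^sub>k\<close> tends to \<open>0\<close>; as \<open>w\<^sub>k - (E x\<^sub>k - E xhat\<^sub>k)\<close> belongs to \<open>F xhat\<^sub>k\<close> and tends to \<open>0\<close>,
  maximality of \<open>F\<close> puts all weak cluster points into \<open>zer F\<close>, and Opial's argument gives weak convergence.
  Metric subregularity bounds the distance of \<open>x\<^sub>k\<close> to \<open>zer F\<close> by a multiple of \<open>norm d\<^sub>k\<close>, which turns
  the decrease into a contraction of that distance, and Fejer monotonicity transfers the rate to \<open>x\<^sub>k\<close>.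
\<close>

section \<open>Convex sets and functionals in Hilbert space\<close>

text \<open>The hypothesis is squared because the parallelogram law controls squared
  distances.\<close>

lemma Cauchy_if_dist_le:
  fixes p :: "nat \<Rightarrow> 'a::metric_space"
  assumes "\<And>m n. n \<le> m \<Longrightarrow> (dist (p n) (p m))\<^sup>2 \<le> e n" and "e \<longlonglongrightarrow> (0::real)"
  shows "Cauchy p"
proof (rule metric_CauchyI)
  fix r :: real assume r: "r > 0"
  then have "(r/2)\<^sup>2 > 0" by simp
  then obtain N where N: "e N < (r/2)\<^sup>2"
    using order_tendstoD(2)[OF assms(2)] eventually_sequentially by (metis order_refl)
  have *: "dist (p N) (p m) < r/2" if "m \<ge> N" for m
    using assms(1)[OF that] N r by (intro power2_less_imp_less[of _ "r/2"]) auto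
  have "dist (p m) (p n) < r" if "m \<ge> N" "n \<ge> N" for m n
    using *[OF that(1)] *[OF that(2)] dist_triangle3[of "p m" "p n" "p N"] by linarith
  then show "\<exists>M. \<forall>m\<ge>M. \<forall>n\<ge>M. dist (p m) (p n) < r" by blast
qed

lemma parallelogram_midpoint:
  fixes x y :: "'a::real_inner"
  shows "(norm (x - y))\<^sup>2 = 2 * (norm x)\<^sup>2 + 2 * (norm y)\<^sup>2 - 4 * (norm ((1/2) *\<^sub>R x + (1/2) *\<^sub>R y))\<^sup>2"
  unfolding power2_norm_eq_inner by (simp add: inner_simps inner_commute algebra_simps)

text \<open>A substitute for weak compactness: near-minimal-norm points of the \<open>C n\<close> form a Cauchy sequence.\<close>

lemma decseq_convex_closures_Int_nonempty:
  fixes C :: "nat \<Rightarrow> 'a::{real_inner, complete_space} set"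
  assumes dec: "decseq C" and ne: "\<And>n. C n \<noteq> {}" and conv: "\<And>n. convex (C n)" and bd: "bounded (C 0)"
  shows "(\<Inter>n. closure (C n)) \<noteq> {}"
proof -
  define d where "d n = (INF y\<in>C n. (norm y)\<^sup>2)" for n
  have bdd: "bdd_below ((\<lambda>y. (norm y)\<^sup>2) ` C n)" for n by (intro bdd_belowI[of _ 0]) auto
  have "\<exists>y\<in>C n. (norm y)\<^sup>2 < d n + 1 / Suc n" for n
    using cINF_less_iff[OF ne bdd, of n "d n + 1 / Suc n"] unfolding d_def by auto
  then obtain p where p: "\<And>n. p n \<in> C n" "\<And>n. (norm (p n))\<^sup>2 < d n + 1 / Suc n" by metis
  have dle: "d n \<le> (norm y)\<^sup>2" if "y \<in> C n" for n y
    unfolding d_def by (rule cINF_lower[OF bdd that])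
  have sub: "C m \<subseteq> C n" if "n \<le> m" for m n using dec that by (simp add: decseq_def)
  have dmono: "incseq d"
    unfolding incseq_def d_def using sub ne bdd by (intro allI impI cINF_superset_mono) auto
  obtain R where R: "\<And>y. y \<in> C 0 \<Longrightarrow> norm y \<le> R" using bd bounded_iff by blast
  have dR: "d n \<le> R\<^sup>2" for n
    using dle[OF p(1)[of n]] power_mono[OF R norm_ge_zero, of "p n" 2] p(1)[of n] sub[of 0 n] by auto
  obtain s where s: "d \<longlonglongrightarrow> s" "\<And>n. d n \<le> s"
    using incseq_convergent[OF dmono, of "R\<^sup>2"] dR by blast
  have "Cauchy p"
  proof (rule Cauchy_if_dist_le)
    fix m n :: nat assume nm: "n \<le> m"
    \<comment> \<open>The midpoint stays in the larger set \<open>C n\<close>, so \<open>d n\<close>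
      bounds its squared norm from below. Both endpoints have squared norm close to the limit
      \<open>s\<close>, and the parallelogram law forces them together.\<close>
    have "(1/2) *\<^sub>R p n + (1/2) *\<^sub>R p m \<in> C n"
      using convexD[OF conv[of n], of "p n" "p m" "1/2" "1/2"] p(1) sub[OF nm] by auto
    then have "d n \<le> (norm ((1/2) *\<^sub>R p n + (1/2) *\<^sub>R p m))\<^sup>2" by (rule dle)
    moreover have "(norm (p m))\<^sup>2 \<le> s + 1 / Suc n"
      using p(2)[of m] s(2)[of m] nm frac_le[of 1 1 "real (Suc n)" "real (Suc m)"] by simp
    ultimately have "(norm (p n - p m))\<^sup>2 \<le> 2 * (d n + 1 / Suc n) + 2 * (s + 1 / Suc n) - 4 * d n"
      unfolding parallelogram_midpoint using p(2)[of n] by (intro diff_mono add_mono mult_left_mono) auto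
    then have "(norm (p n - p m))\<^sup>2 \<le> 2 * (s - d n) + 4 * (1 / Suc n)" by argo
    then show "(dist (p n) (p m))\<^sup>2 \<le> 2 * (s - d n) + 4 * (1 / Suc n)" by (simp add: dist_norm)
  next
    show "(\<lambda>n. 2 * (s - d n) + 4 * (1 / Suc n)) \<longlonglongrightarrow> 0"
      using tendsto_add[OF tendsto_mult_left[OF tendsto_diff[OF tendsto_const s(1)]]
          tendsto_mult_left[OF LIMSEQ_inverse_real_of_nat], of 2 s 4]
      by (simp add: inverse_eq_divide)
  qed
  then obtain q where q: "p \<longlonglongrightarrow> q" using Cauchy_convergent_iff convergent_def by blast
  have "q \<in> closure (C n)" for n
  proof (rule Lim_in_closed_set[OF closed_closure _ _ q])
    show "\<forall>\<^sub>F m in sequentially. p m \<in> closure (C n)"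
      unfolding eventually_sequentially using p(1) sub[of n] closure_subset[of "C n"] by blast
  qed simp
  then show ?thesis by blast
qed

text \<open>Cutting \<open>C\<close> with balls of radius slightly above the infimum
  \<open>s\<close> gives a decreasing sequence of closed bounded convex sets; a common point has
  norm at most \<open>s\<close>.\<close>

lemma closed_convex_has_min_norm:
  fixes C :: "'a::{real_inner, complete_space} set"
  assumes "closed C" "convex C" "C \<noteq> {}"
  obtains p where "p \<in> C" "\<And>y. y \<in> C \<Longrightarrow> norm p \<le> norm y"
proof -
  define s where "s = (INF y\<in>C. norm y)"
  have bdd: "bdd_below (norm ` C)" by (intro bdd_belowI[of _ 0]) auto
  define C' where "C' n = C \<inter> cball 0 (s + 1 / Suc n)" for n
  have "(\<Inter>n. closure (C' n)) \<noteq> {}"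
  proof (rule decseq_convex_closures_Int_nonempty)
    have "1 / real (Suc m) \<le> 1 / real (Suc n)" if "n \<le> m" for m n using that by (simp add: frac_le)
    then show "decseq C'" unfolding decseq_def C'_def by force
    show "C' n \<noteq> {}" for n
    proof -
      obtain y where "y \<in> C" "norm y < s + 1 / Suc n"
        using cINF_less_iff[OF assms(3) bdd, of "s + 1 / Suc n"] unfolding s_def by auto
      then show ?thesis unfolding C'_def by (auto intro: less_imp_le)
    qed
    show "convex (C' n)" for n unfolding C'_def by (intro convex_Int assms convex_cball)
    show "bounded (C' 0)" unfolding C'_def by (intro bounded_Int) auto
  qed
  moreover have "\<And>n. closure (C' n) = C' n"
    unfolding C'_def by (intro closure_closed closed_Int assms closed_cball)
  ultimately have "(\<Inter>n. C' n) \<noteq> {}" by simp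
  then obtain p where "p \<in> (\<Inter>n. C' n)" by (meson ex_in_conv)
  then have p: "p \<in> C' n" for n by simp
  have "(\<lambda>n. s + 1 / Suc n) \<longlonglongrightarrow> s + 0"
    using LIMSEQ_inverse_real_of_nat by (intro tendsto_add tendsto_const) (simp add: inverse_eq_divide)
  moreover have "norm p \<le> s + 1 / Suc n" for n using p[of n] by (simp add: C'_def)
  ultimately have "norm p \<le> s" using LIMSEQ_le_const[of "\<lambda>n. s + 1 / Suc n" "s + 0" "norm p"] by simp
  then show ?thesis
    using that[of p] p[of 0] cINF_lower[OF bdd] order_trans unfolding C'_def s_def by blast
qed

section \<open>Riesz representation and adjoints\<close>

lemma inner_eq_0_if_norm_minimal:
  fixes p h :: "'a::real_inner"
  assumes "\<And>t. norm p \<le> norm (p + t *\<^sub>R h)"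
  shows "inner p h = 0"
proof (cases "h = 0")
  case False
  then have pos: "inner h h > 0" by simp
  \<comment> \<open>The minimizer of the quadratic \<open>norm (p + t *\<^sub>R h)\<close> squared
    in \<open>t\<close>.\<close>
  define t where "t = - inner p h / inner h h"
  have "(norm p)\<^sup>2 \<le> (norm (p + t *\<^sub>R h))\<^sup>2" using assms by (intro power_mono) auto
  then have "0 \<le> 2 * t * inner p h + t * (t * inner h h)"
    unfolding power2_norm_eq_inner by (simp add: inner_simps inner_commute algebra_simps)
  moreover have "t * inner h h = - inner p h" using pos by (simp add: t_def)
  ultimately have "0 \<le> t * inner p h" by (simp add: algebra_simps)
  then have "(inner p h)\<^sup>2 \<le> 0" using pos unfolding t_def by (simp add: zero_le_divide_iff divide_le_0_iff power2_eq_square)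
  then show ?thesis by simp
qed simp

text \<open>The point \<open>p\<close> of least norm on the hyperplane where \<open>f\<close> equals
  1 is orthogonal to the kernel of \<open>f\<close>, and \<open>y - f y *\<^sub>R p\<close> lies in
  that kernel. Rescaling \<open>p\<close> gives the representer.\<close>

lemma riesz_representation:
  fixes f :: "'a::{real_inner, complete_space} \<Rightarrow> real"
  assumes "bounded_linear f"
  obtains v where "\<And>y. f y = inner y v"
proof (cases "\<forall>y. f y = 0")
  case True
  then show ?thesis using that[of 0] by simp
next
  case False
  interpret bounded_linear f by fact
  obtain y0 where y0: "f y0 \<noteq> 0" using False by blast
  have "f ((1 / f y0) *\<^sub>R y0) = 1" using y0 by (simp add: scale)
  then have "{y. f y = 1} \<noteq> {}" by blast
  moreover have "closed {y. f y = 1}"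
    by (intro closed_Collect_eq continuous_intros linear_continuous_on assms)
  moreover have "convex {y. f y = 1}" by (auto simp: convex_def add scale)
  ultimately obtain p where "p \<in> {y. f y = 1}" "\<And>y. y \<in> {y. f y = 1} \<Longrightarrow> norm p \<le> norm y"
    using closed_convex_has_min_norm[of "{y. f y = 1}"] by metis
  then have p: "f p = 1" "\<And>y. f y = 1 \<Longrightarrow> norm p \<le> norm y" by auto
  have pp: "inner p p \<noteq> 0" using p(1) zero by auto
  have "f y = inner y ((1 / inner p p) *\<^sub>R p)" for y
  proof -
    have "inner p (y - f y *\<^sub>R p) = 0"
      by (intro inner_eq_0_if_norm_minimal p(2)) (simp add: add scale diff p(1))
    then have "inner p y = f y * inner p p" by (simp add: inner_diff_right)
    then show ?thesis using pp by (simp add: inner_commute)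
  qed
  then show ?thesis by (rule that)
qed

text \<open>Since \<open>adjoint\<close> is defined by choice, its property holds only once some
  adjoint exists; Riesz representation provides one.\<close>

lemma adjoint_works_hilbert:
  fixes f :: "'a::{real_inner, complete_space} \<Rightarrow> 'b::real_inner"
  assumes "bounded_linear f"
  shows "inner (f x) y = inner x (adjoint f y)"
proof -
  have "\<exists>v. \<forall>x. inner (f x) y = inner x v" for y
    using riesz_representation[OF bounded_linear_compose[OF bounded_linear_inner_left assms], of y] by metis
  then have "\<exists>f'. \<forall>x y. inner (f x) y = inner x (f' y)" by metis
  then show ?thesis unfolding adjoint_def by (rule someI2_ex) blast
qed

section \<open>Surjectivity for maximally monotone operators\<close>

text \<open>
  Solving \<open>- x \<in> A x\<close> means finding a common point of the balls with centres
  \<open>(y - v) /\<^sub>R 2\<close> and radii \<open>norm (y + v) / 2\<close>, for \<open>(y, v)\<close> in the graph. On the convex hull of the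
  points \<open>(y, v, inner v y)\<close> the last component still dominates \<open>inner v y\<close>, and the strongly convex
  function \<open>\<phi>\<close> measures how far a convex combination of centres is from being such a common point.
\<close>

lemma monotone_graph_common_point:
  fixes G :: "('a::{real_inner, complete_space} \<times> 'a) set"
  assumes mono: "\<And>y v y' v'. (y, v) \<in> G \<Longrightarrow> (y', v') \<in> G \<Longrightarrow> 0 \<le> inner (v - v') (y - y')"
    and ne: "G \<noteq> {}"
  obtains x where "\<And>y v. (y, v) \<in> G \<Longrightarrow> 0 \<le> inner (- x - v) (x - y)"
proof -
  define T where "T = convex hull ((\<lambda>(y, v). (y, v, inner v y)) ` G)"
  \<comment> \<open>On two graph points \<open>q\<close> is the monotonicity pairing
    \<open>inner (v - v') (y - y')\<close>. It respects convex combinations in each argument, so its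
    sign passes to the hull one argument at a time; on the diagonal it equals
    \<open>2 * (r - inner v y)\<close>.\<close>
  define q :: "'a \<times> 'a \<times> real \<Rightarrow> 'a \<times> 'a \<times> real \<Rightarrow> real" where
    "q = (\<lambda>(y, v, r) (y', v', r'). r + r' - inner v y' - inner v' y)"
  have convT: "convex T" unfolding T_def by (rule convex_convex_hull)
  have GT: "(y, v, inner v y) \<in> T" if "(y, v) \<in> G" for y v
    unfolding T_def by (rule hull_inc) (rule image_eqI[OF _ that], simp)
  have conv_q: "convex {w. 0 \<le> q w w'}" for w'
  proof (rule convexI)
    fix w1 w2 and s t :: real
    assume a: "w1 \<in> {w. 0 \<le> q w w'}" "w2 \<in> {w. 0 \<le> q w w'}" and st: "0 \<le> s" "0 \<le> t" "s + t = 1"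
    have "q (s *\<^sub>R w1 + t *\<^sub>R w2) w' = s * q w1 w' + t * q w2 w' + (1 - (s + t)) * snd (snd w')"
      unfolding q_def by (auto simp: split_beta inner_simps algebra_simps)
    then show "s *\<^sub>R w1 + t *\<^sub>R w2 \<in> {w. 0 \<le> q w w'}" using a st by simp
  qed
  have q_comm: "q w w' = q w' w" for w w' by (auto simp: q_def split_beta)
  have q1: "0 \<le> q w (y', v', inner v' y')" if "w \<in> T" "(y', v') \<in> G" for w y' v'
  proof -
    have "T \<subseteq> {w. 0 \<le> q w (y', v', inner v' y')}"
      unfolding T_def
      by (rule hull_minimal[where S = convex, OF _ conv_q])
        (use mono[OF _ that(2)] in \<open>auto simp: q_def inner_simps inner_commute algebra_simps\<close>)
    then show ?thesis using that by blast
  qed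
  have "T \<subseteq> {w. 0 \<le> q w w'}" if "w' \<in> T" for w'
    unfolding T_def
    by (rule hull_minimal[where S = convex, OF _ conv_q]) (use q1[OF that] q_comm[of _ w'] in auto)
  then have r_ge: "inner v y \<le> r" if "(y, v, r) \<in> T" for y v r
    using that unfolding q_def by fastforce
  define b :: "'a \<times> 'a \<times> real \<Rightarrow> 'a" where "b = (\<lambda>(y, v, r). (1/2) *\<^sub>R (y - v))"
  \<comment> \<open>On a graph point this is the squared radius of its ball; the quadratic term
    makes it strongly convex along the centres \<open>b w\<close>.\<close>
  define \<phi> where "\<phi> w = (norm (b w))\<^sup>2 + snd (snd w)" for w
  have \<phi>_nonneg: "0 \<le> \<phi> w" if "w \<in> T" for w
  proof -
    obtain y v r where w: "w = (y, v, r)" by (metis prod_cases3)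
    have "0 \<le> (norm ((1/2) *\<^sub>R (y + v)))\<^sup>2" by simp
    also have "\<dots> = (norm (b w))\<^sup>2 + inner v y"
      unfolding power2_norm_eq_inner w b_def by (simp add: inner_simps inner_commute algebra_simps)
    finally show ?thesis using r_ge[of y v r] that unfolding \<phi>_def w by simp
  qed
  have lin_b: "b (s *\<^sub>R w + t *\<^sub>R w') = s *\<^sub>R b w + t *\<^sub>R b w'" for s t w w'
    unfolding b_def by (auto simp: split_beta algebra_simps)
  have \<phi>_conv: "\<phi> ((1 - t) *\<^sub>R w + t *\<^sub>R w') = (1 - t) * \<phi> w + t * \<phi> w' - t * (1 - t) * (norm (b w - b w'))\<^sup>2"
    for t w w'
    unfolding \<phi>_def lin_b power2_norm_eq_inner
    by (simp add: inner_simps inner_commute algebra_simps)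
  have Tne: "T \<noteq> {}" using ne unfolding T_def by simp
  define s where "s = (INF w\<in>T. \<phi> w)"
  have bdd: "bdd_below (\<phi> ` T)" using \<phi>_nonneg by (intro bdd_belowI[of _ 0]) auto
  have s_le: "s \<le> \<phi> w" if "w \<in> T" for w unfolding s_def by (rule cINF_lower[OF bdd that])
  have s0: "0 \<le> s" unfolding s_def by (rule cINF_greatest[OF Tne \<phi>_nonneg])
  have strong: "t * (1 - t) * (norm (b w - b w'))\<^sup>2 \<le> (1 - t) * \<phi> w + t * \<phi> w' - s"
    if "w \<in> T" "w' \<in> T" "0 \<le> t" "t \<le> 1" for w w' t
    using s_le[OF convexD[OF convT that(1,2), of "1 - t" t]] that \<phi>_conv[of t w w'] by auto
  \<comment> \<open>The common point is found in the closures of the centres of near-minimizers of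
    \<open>\<phi>\<close>, which shrink by strong convexity.\<close>
  define L where "L n = T \<inter> {w. \<phi> w \<le> s + 1 / Suc n}" for n
  have "(\<Inter>n. closure (b ` L n)) \<noteq> {}"
  proof (rule decseq_convex_closures_Int_nonempty)
    have "L m \<subseteq> L n" if "n \<le> m" for m n
      using frac_le[of 1 1 "real (Suc n)" "real (Suc m)"] that unfolding L_def by auto
    then show "decseq (\<lambda>n. b ` L n)" unfolding decseq_def by blast
    show "b ` L n \<noteq> {}" for n
    proof -
      obtain w where "w \<in> T" "\<phi> w < s + 1 / Suc n"
        using cINF_less_iff[OF Tne bdd, of "s + 1 / Suc n"] unfolding s_def by auto
      then show ?thesis unfolding L_def by auto
    qed
    show "convex (b ` L n)" for n
    proof (rule convex_linear_image)
      show "linear b" using lin_b[of 1 _ 1] lin_b[of _ _ 0] by (intro linearI) auto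
      show "convex (L n)"
        unfolding convex_alt
      proof (intro ballI allI impI)
        fix w w' and t :: real
        assume w: "w \<in> L n" "w' \<in> L n" and t: "0 \<le> t \<and> t \<le> 1"
        have "\<phi> ((1 - t) *\<^sub>R w + t *\<^sub>R w') \<le> (1 - t) * \<phi> w + t * \<phi> w'"
          using t unfolding \<phi>_conv by simp
        also have "\<dots> \<le> (1 - t) * (s + 1 / Suc n) + t * (s + 1 / Suc n)"
          using w t by (intro add_mono mult_left_mono) (auto simp: L_def)
        also have "\<dots> = s + 1 / Suc n" by (simp only: distrib_right[symmetric]) simp
        finally show "(1 - t) *\<^sub>R w + t *\<^sub>R w' \<in> L n"
          using w t convT unfolding L_def convex_alt by auto
      qed
    qed
    show "bounded (b ` L 0)"
    proof -
      obtain w where w: "w \<in> T" using Tne by blast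
      have "dist (b w) (b w') \<le> sqrt (4 * ((\<phi> w + (s + 1)) / 2))" if "w' \<in> L 0" for w'
        using strong[of w w' "1/2"] that w s0 unfolding L_def dist_norm
        by (intro real_le_rsqrt) auto
      then show ?thesis unfolding bounded_def by blast
    qed
  qed
  then obtain x where x: "\<And>n. x \<in> closure (b ` L n)" by blast
  have ball: "(norm (x - b w))\<^sup>2 \<le> \<phi> w" if w: "w \<in> T" for w
  proof -
    have *: "t * (1 - t) * (norm (x - b w))\<^sup>2 \<le> 1 / Suc n + t * \<phi> w"
      if t: "0 \<le> t" "t \<le> 1" for t n
    proof -
      have "closure (b ` L n) \<subseteq> {z. t * (1 - t) * (norm (z - b w))\<^sup>2 \<le> 1 / Suc n + t * \<phi> w}"
      proof (rule closure_minimal)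
        show "closed {z. t * (1 - t) * (norm (z - b w))\<^sup>2 \<le> 1 / Suc n + t * \<phi> w}"
          by (intro closed_Collect_le continuous_intros)
        have "t * (1 - t) * (norm (b w' - b w))\<^sup>2 \<le> 1 / Suc n + t * \<phi> w" if w': "w' \<in> L n" for w'
        proof -
          have "(1 - t) * \<phi> w' \<le> (1 - t) * s + (1 - t) * (1 / Suc n)"
            using w' t unfolding L_def distrib_left[symmetric] by (intro mult_left_mono) auto
          also have "\<dots> \<le> s + 1 / Suc n"
            using t s0 by (intro add_mono mult_left_le_one_le) auto
          finally show ?thesis using strong[of w' w t] w' w t unfolding L_def by auto
        qed
        then show "b ` L n \<subseteq> {z. t * (1 - t) * (norm (z - b w))\<^sup>2 \<le> 1 / Suc n + t * \<phi> w}" by auto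
      qed
      then show ?thesis using x by blast
    qed
    \<comment> \<open>First \<open>n\<close> goes to infinity with \<open>t\<close> fixed, then
      \<open>t\<close> is cancelled; afterwards \<open>t = 1 / Suc n\<close> tends to 0 and leaves
      the ball inequality.\<close>
    have **: "(1 - t) * (norm (x - b w))\<^sup>2 \<le> \<phi> w" if t: "0 < t" "t \<le> 1" for t
    proof -
      have "(\<lambda>n. 1 / Suc n + t * \<phi> w) \<longlonglongrightarrow> 0 + t * \<phi> w"
        using LIMSEQ_inverse_real_of_nat by (intro tendsto_add tendsto_const) (simp add: inverse_eq_divide)
      then have "t * (1 - t) * (norm (x - b w))\<^sup>2 \<le> 0 + t * \<phi> w"
        by (rule LIMSEQ_le_const) (use *[of t] t in auto)
      then show ?thesis using t by (simp add: mult.assoc)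
    qed
    have "(\<lambda>n. (1 - 1 / Suc n) * (norm (x - b w))\<^sup>2) \<longlonglongrightarrow> (1 - 0) * (norm (x - b w))\<^sup>2"
      using LIMSEQ_inverse_real_of_nat by (intro tendsto_intros) (simp add: inverse_eq_divide)
    then have "(1 - 0) * (norm (x - b w))\<^sup>2 \<le> \<phi> w"
      by (rule LIMSEQ_le_const2) (use **[of "1 / Suc _"] in auto)
    then show ?thesis by simp
  qed
  have "0 \<le> inner (- x - v) (x - y)" if "(y, v) \<in> G" for y v
  proof -
    \<comment> \<open>The ball inequality at a graph point expands exactly to the claim, the squared
      norm of the centre cancelling.\<close>
    have "(norm (x - (1/2) *\<^sub>R (y - v)))\<^sup>2 \<le> (norm ((1/2) *\<^sub>R (y - v)))\<^sup>2 + inner v y"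
      using ball[OF GT[OF that]] by (simp add: \<phi>_def b_def)
    then show ?thesis
      unfolding power2_norm_eq_inner by (simp add: inner_simps inner_commute algebra_simps)
  qed
  then show ?thesis by (rule that)
qed

section \<open>Minty's theorem and Lipschitz perturbations\<close>

text \<open>Adjoining \<open>(x, u)\<close> to the graph keeps it monotone, so maximality means that
  it was already there.\<close>

lemma maximally_monotone_memI:
  assumes max: "maximally_monotone A"
    and mono: "\<And>y v. v \<in> A y \<Longrightarrow> 0 \<le> inner (u - v) (x - y)"
  shows "u \<in> A x"
proof -
  define A' where "A' y = (if y = x then insert u (A y) else A y)" for y
  have "monotone_op A"
    and ext: "\<And>A'. monotone_op A' \<Longrightarrow> op_graph A \<subseteq> op_graph A' \<Longrightarrow> op_graph A' = op_graph A"
    using max unfolding maximally_monotone_def by blast+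
  moreover have "0 \<le> inner (v - u) (y - x)" if "v \<in> A y" for y v
    using mono[OF that] by (simp add: inner_simps)
  ultimately have "monotone_op A'"
    using mono unfolding monotone_op_def A'_def by (auto split: if_splits)
  moreover have "op_graph A \<subseteq> op_graph A'" unfolding op_graph_def A'_def by auto
  ultimately have "op_graph A' = op_graph A" by (intro ext)
  then have "(x, u) \<in> op_graph A" unfolding op_graph_def A'_def by auto
  then show ?thesis by (simp add: op_graph_def)
qed

lemma maximally_monotone_nonempty:
  assumes "maximally_monotone A"
  shows "\<exists>y v. v \<in> A y"
proof (rule ccontr)
  assume *: "\<not> ?thesis"
  then have "0 \<in> A 0" using maximally_monotone_memI[OF assms, of 0 0] by blast
  with * show False by blast
qed

text \<open>Here \<open>G\<close> is the graph of \<open>\<tau> A - z\<close>. A point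
  \<open>x\<close> for which \<open>(x, - x)\<close> is monotonically related to \<open>G\<close>
  solves the inclusion by maximality.\<close>

lemma minty:
  fixes A :: "'a::{real_inner, complete_space} \<Rightarrow> 'a set"
  assumes max: "maximally_monotone A" and \<tau>: "0 < \<tau>"
  shows "\<exists>x. \<exists>a\<in>A x. x + \<tau> *\<^sub>R a = z"
proof -
  define G where "G = {(y, \<tau> *\<^sub>R v - z) | y v. v \<in> A y}"
  have mono: "0 \<le> inner (v - v') (y - y')" if "v \<in> A y" "v' \<in> A y'" for y v y' v'
    using max that unfolding maximally_monotone_def monotone_op_def by blast
  have "G \<noteq> {}" using maximally_monotone_nonempty[OF max] unfolding G_def by auto
  moreover have "0 \<le> inner (w - w') (y - y')" if yw: "(y, w) \<in> G" "(y', w') \<in> G" for y w y' w'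
  proof -
    obtain v v' where v: "v \<in> A y" "v' \<in> A y'" "w = \<tau> *\<^sub>R v - z" "w' = \<tau> *\<^sub>R v' - z"
      using yw unfolding G_def by blast
    have "inner (w - w') (y - y') = \<tau> * inner (v - v') (y - y')"
      unfolding v(3,4) by (simp add: inner_simps algebra_simps)
    then show ?thesis using mono[OF v(1,2)] \<tau> by simp
  qed
  ultimately obtain x where x: "\<And>y w. (y, w) \<in> G \<Longrightarrow> 0 \<le> inner (- x - w) (x - y)"
    using monotone_graph_common_point[of G] by metis
  have "(1 / \<tau>) *\<^sub>R (z - x) \<in> A x"
  proof (rule maximally_monotone_memI[OF max])
    fix y v assume "v \<in> A y"
    then have "0 \<le> inner (- x - (\<tau> *\<^sub>R v - z)) (x - y)" by (intro x) (auto simp: G_def)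
    also have "- x - (\<tau> *\<^sub>R v - z) = \<tau> *\<^sub>R ((1 / \<tau>) *\<^sub>R (z - x) - v)"
      using \<tau> by (simp add: algebra_simps)
    finally show "0 \<le> inner ((1 / \<tau>) *\<^sub>R (z - x) - v) (x - y)"
      using \<tau> by (simp add: zero_le_mult_iff)
  qed
  moreover have "x + \<tau> *\<^sub>R ((1 / \<tau>) *\<^sub>R (z - x)) = z" using \<tau> by simp
  ultimately show ?thesis by blast
qed

text \<open>The resolvent \<open>J\<close> of \<open>\<tau> A\<close> is nonexpansive, so
  \<open>J (z - \<tau> *\<^sub>R G x)\<close> is a contraction in \<open>x\<close> and its fixed
  point is the solution. It is applied with \<open>G\<close> equal to \<open>E + K\<close> and to
  \<open>- D\<close>; monotonicity of \<open>G\<close> is not at issue, only the size of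
  \<open>\<tau> * L\<close>.\<close>

lemma maximally_monotone_add_lipschitz_surj:
  fixes A :: "'a::{real_inner, complete_space} \<Rightarrow> 'a set"
  assumes max: "maximally_monotone A" and \<tau>: "0 < \<tau>"
    and lip: "\<And>x y. norm (G x - G y) \<le> L * norm (x - y)" and L: "0 \<le> L" "\<tau> * L < 1"
  shows "\<exists>x. \<exists>a\<in>A x. x + \<tau> *\<^sub>R (a + G x) = z"
proof -
  obtain J a where J: "\<And>u. a u \<in> A (J u)" "\<And>u. J u + \<tau> *\<^sub>R a u = u"
    using minty[OF max \<tau>] by metis
  have nonexp: "norm (J u - J v) \<le> norm (u - v)" for u v
  proof -
    have "0 \<le> inner (a u - a v) (J u - J v)"
      using max J(1) unfolding maximally_monotone_def monotone_op_def by blast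
    then have "0 \<le> inner (\<tau> *\<^sub>R a u - \<tau> *\<^sub>R a v) (J u - J v)"
      using \<tau> by (simp add: scaleR_diff_right[symmetric])
    moreover have "\<tau> *\<^sub>R a u - \<tau> *\<^sub>R a v = (u - v) - (J u - J v)"
      using J(2)[of u] J(2)[of v] by (simp add: algebra_simps)
    ultimately have "(norm (J u - J v))\<^sup>2 \<le> inner (u - v) (J u - J v)"
      by (simp add: inner_diff_left power2_norm_eq_inner)
    also have "\<dots> \<le> norm (u - v) * norm (J u - J v)" by (rule norm_cauchy_schwarz)
    finally show ?thesis by (cases "J u = J v") (simp_all add: power2_eq_square)
  qed
  have "\<exists>!x. J (z - \<tau> *\<^sub>R G x) = x"
  proof (rule banach_fix_type)
    show "0 \<le> \<tau> * L" using \<tau> L by simp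
    show "\<forall>x y. dist (J (z - \<tau> *\<^sub>R G x)) (J (z - \<tau> *\<^sub>R G y)) \<le> (\<tau> * L) * dist x y"
    proof (intro allI)
      fix x y
      have "norm (J (z - \<tau> *\<^sub>R G x) - J (z - \<tau> *\<^sub>R G y)) \<le> norm (\<tau> *\<^sub>R (G y - G x))"
        using nonexp[of "z - \<tau> *\<^sub>R G x" "z - \<tau> *\<^sub>R G y"] by (simp add: algebra_simps)
      also have "\<dots> \<le> \<tau> * (L * norm (x - y))"
        using lip[of y x] \<tau> by (simp add: norm_minus_commute)
      finally show "dist (J (z - \<tau> *\<^sub>R G x)) (J (z - \<tau> *\<^sub>R G y)) \<le> (\<tau> * L) * dist x y"
        by (simp add: dist_norm)
    qed
  qed (fact L)
  then obtain x where x: "J (z - \<tau> *\<^sub>R G x) = x" by blast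
  show ?thesis
    using J[of "z - \<tau> *\<^sub>R G x"] unfolding x
    by (intro exI[of _ x] bexI[of _ "a (z - \<tau> *\<^sub>R G x)"]) (simp_all add: algebra_simps)
qed

section \<open>The metric of a positive definite operator\<close>

locale pos_def_operator =
  fixes S :: "'a::{real_inner, complete_space} \<Rightarrow> 'a"
  assumes pos_def: "pos_def_op S"
begin

lemma bounded_linear_S: "bounded_linear S" and adjoint_S: "adjoint S = S"
  using pos_def unfolding pos_def_op_def by auto

sublocale bounded_linear S by (fact bounded_linear_S)

lemma symmetric: "inner (S x) y = inner x (S y)"
  using adjoint_works_hilbert[OF bounded_linear_S] by (simp add: adjoint_S)

lemma bounds:
  obtains l u where "0 < l" "l \<le> u" "\<And>x. l * (norm x)\<^sup>2 \<le> inner x (S x)" "\<And>x. inner x (S x) \<le> u * (norm x)\<^sup>2"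
  using pos_def unfolding pos_def_op_def by blast

lemma inner_self_nonneg: "0 \<le> inner x (S x)"
proof -
  obtain l where "0 < l" "l * (norm x)\<^sup>2 \<le> inner x (S x)" using bounds by metis
  then show ?thesis by (meson order_trans mult_nonneg_nonneg less_imp_le zero_le_power2)
qed

lemma inner_self_eq_0_iff: "inner x (S x) = 0 \<longleftrightarrow> x = 0"
proof -
  obtain l where l: "0 < l" "l * (norm x)\<^sup>2 \<le> inner x (S x)" using bounds by metis
  have "x = 0" if "inner x (S x) = 0"
  proof -
    have "l * (norm x)\<^sup>2 \<le> 0" using l(2) that by simp
    then show ?thesis using l(1) by (simp add: mult_le_0_iff)
  qed
  then show ?thesis by (auto simp: zero)
qed

lemma norm_wrt_power2: "(norm_wrt S x)\<^sup>2 = inner x (S x)"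
  by (simp add: norm_wrt_def inner_self_nonneg)

lemma norm_wrt_nonneg: "0 \<le> norm_wrt S x"
  by (simp add: norm_wrt_def inner_self_nonneg)

lemma cauchy_schwarz_wrt: "inner x (S y) \<le> norm_wrt S x * norm_wrt S y"
proof (cases "y = 0")
  case True
  then show ?thesis by (simp add: norm_wrt_def zero)
next
  case False
  then have pos: "0 < inner y (S y)" using inner_self_nonneg[of y] inner_self_eq_0_iff[of y] by linarith
  \<comment> \<open>The minimizer over \<open>t\<close> of the squared \<open>S\<close>-norm of
    \<open>x - t *\<^sub>R y\<close>.\<close>
  define t where "t = inner x (S y) / inner y (S y)"
  have t: "t * inner y (S y) = inner x (S y)" using pos by (simp add: t_def)
  have "0 \<le> inner (x - t *\<^sub>R y) (S (x - t *\<^sub>R y))" by (rule inner_self_nonneg)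
  also have "\<dots> = inner x (S x) - 2 * t * inner x (S y) + t * (t * inner y (S y))"
    using symmetric[of x y] by (simp add: diff scale inner_simps inner_commute algebra_simps)
  also have "\<dots> = inner x (S x) - (inner x (S y))\<^sup>2 / inner y (S y)"
    unfolding t by (simp add: t_def power2_eq_square)
  finally have "(inner x (S y))\<^sup>2 \<le> inner x (S x) * inner y (S y)"
    using pos by (simp add: field_simps)
  also have "\<dots> = (norm_wrt S x * norm_wrt S y)\<^sup>2" by (simp add: power_mult_distrib norm_wrt_power2)
  finally show ?thesis by (rule power2_le_imp_le) (simp add: norm_wrt_nonneg)
qed

lemma norm_wrt_triangle: "norm_wrt S (x + y) \<le> norm_wrt S x + norm_wrt S y"
proof (rule power2_le_imp_le)
  have "(norm_wrt S (x + y))\<^sup>2 = inner x (S x) + 2 * inner x (S y) + inner y (S y)"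
    using symmetric[of x y] by (simp add: norm_wrt_power2 add inner_simps inner_commute)
  also have "\<dots> \<le> (norm_wrt S x + norm_wrt S y)\<^sup>2"
    using cauchy_schwarz_wrt[of x y] by (simp add: power2_sum norm_wrt_power2)
  finally show "(norm_wrt S (x + y))\<^sup>2 \<le> (norm_wrt S x + norm_wrt S y)\<^sup>2" .
qed (simp add: norm_wrt_nonneg)

lemma norm_wrt_minus: "norm_wrt S (- x) = norm_wrt S x"
  by (simp add: norm_wrt_def neg)

lemma norm_wrt_equiv:
  obtains m n where "0 < m" "0 < n" "\<And>x. m * norm x \<le> norm_wrt S x" "\<And>x. norm_wrt S x \<le> n * norm x"
proof -
  obtain l u where lu: "0 < l" "l \<le> u" "\<And>x. l * (norm x)\<^sup>2 \<le> inner x (S x)"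
    "\<And>x. inner x (S x) \<le> u * (norm x)\<^sup>2" using bounds by blast
  have "sqrt l * norm x \<le> norm_wrt S x" for x
    using real_sqrt_le_mono[OF lu(3)[of x]] by (simp add: norm_wrt_def real_sqrt_mult)
  moreover have "norm_wrt S x \<le> sqrt u * norm x" for x
    using real_sqrt_le_mono[OF lu(4)[of x]] by (simp add: norm_wrt_def real_sqrt_mult)
  ultimately show ?thesis using that[of "sqrt l" "sqrt u"] lu(1,2) by simp
qed

text \<open>Positive definiteness gives injectivity. For surjectivity, the gradient step
  \<open>x - t *\<^sub>R (S x - v)\<close> is a contraction for small \<open>t\<close>, and its
  fixed point solves \<open>S x = v\<close>.\<close>

lemma bij: "bij S"
proof (rule bijI)
  have "x = y" if "S x = S y" for x y
    using inner_self_eq_0_iff[of "x - y"] that by (simp add: diff)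
  then show "inj S" by (rule injI)
  obtain l where l: "0 < l" "\<And>x. l * (norm x)\<^sup>2 \<le> inner x (S x)" using bounds by metis
  obtain C where C: "0 < C" "\<And>x. norm (S x) \<le> norm x * C" using pos_bounded by blast
  \<comment> \<open>Chosen so that \<open>t * C\<^sup>2 = l\<close>: the quadratic term of the
    gradient step then uses up at most half of the linear gain.\<close>
  define t where "t = l / C\<^sup>2"
  have t: "0 < t" using l C by (simp add: t_def)
  have contr: "(norm (x - t *\<^sub>R S x))\<^sup>2 \<le> (1 - t * l) * (norm x)\<^sup>2" for x
  proof -
    have "(norm (S x))\<^sup>2 \<le> (norm x * C)\<^sup>2" using C by (intro power_mono) auto
    then have "t * (norm (S x))\<^sup>2 \<le> t * (norm x * C)\<^sup>2" using t by simp
    also have "\<dots> = l * (norm x)\<^sup>2" using C by (simp add: t_def power_mult_distrib)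
    also have "\<dots> \<le> inner x (S x)" by (rule l)
    finally have "t * (t * (norm (S x))\<^sup>2) \<le> t * inner x (S x)" using t by simp
    moreover have "t * (l * (norm x)\<^sup>2) \<le> t * inner x (S x)" using t l(2) by simp
    moreover have "(norm (x - t *\<^sub>R S x))\<^sup>2 = (norm x)\<^sup>2 - 2 * t * inner x (S x) + t * (t * (norm (S x))\<^sup>2)"
      unfolding power2_norm_eq_inner by (simp add: inner_simps inner_commute algebra_simps)
    ultimately show ?thesis by (simp add: algebra_simps)
  qed
  have "\<exists>x. S x = v" for v
  proof -
    have "\<exists>!x. x - t *\<^sub>R (S x - v) = x"
    proof (rule banach_fix_type)
      \<comment> \<open>The \<open>max 0\<close> covers the zero space, where \<open>t * l\<close>
        may exceed 1.\<close>
      show "0 \<le> sqrt (max 0 (1 - t * l))" "sqrt (max 0 (1 - t * l)) < 1" using t l by auto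
      show "\<forall>x y. dist (x - t *\<^sub>R (S x - v)) (y - t *\<^sub>R (S y - v)) \<le> sqrt (max 0 (1 - t * l)) * dist x y"
      proof (intro allI)
        fix x y
        have "(norm ((x - y) - t *\<^sub>R S (x - y)))\<^sup>2 \<le> max 0 (1 - t * l) * (norm (x - y))\<^sup>2"
          by (rule order_trans[OF contr]) (intro mult_right_mono, auto)
        then have "norm ((x - y) - t *\<^sub>R S (x - y)) \<le> sqrt (max 0 (1 - t * l)) * norm (x - y)"
          using real_le_rsqrt by (fastforce simp: real_sqrt_mult)
        then show "dist (x - t *\<^sub>R (S x - v)) (y - t *\<^sub>R (S y - v)) \<le> sqrt (max 0 (1 - t * l)) * dist x y"
          by (simp add: dist_norm diff algebra_simps)
      qed
    qed
    then obtain x where "x - t *\<^sub>R (S x - v) = x" by blast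
    then show ?thesis using t by auto
  qed
  then show "surj S" by (metis surjI)
qed

lemma S_inv: "S (inv S w) = w"
  using bij by (simp add: bij_is_surj surj_f_inv_f)

lemma norm_wrt_inv_power2: "(norm_wrt (inv S) w)\<^sup>2 = inner w (inv S w)"
proof -
  have "0 \<le> inner (inv S w) (S (inv S w))" by (rule inner_self_nonneg)
  then show ?thesis unfolding S_inv by (simp add: norm_wrt_def inner_commute)
qed

lemma inner_inv_pos: "w \<noteq> 0 \<Longrightarrow> 0 < inner w (inv S w)"
  using inner_self_nonneg[of "inv S w"] inner_self_eq_0_iff[of "inv S w"] zero S_inv[of w]
  by (metis inner_commute less_eq_real_def)

lemma inner_inv_le:
  obtains u where "0 < u" "\<And>w. inner w (inv S w) \<le> u * (norm w)\<^sup>2"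
proof -
  obtain l where l: "0 < l" "\<And>x. l * (norm x)\<^sup>2 \<le> inner x (S x)" using bounds by metis
  have "inner w (inv S w) \<le> (1 / l) * (norm w)\<^sup>2" for w
  proof -
    define y where "y = inv S w"
    have "l * (norm y)\<^sup>2 \<le> inner y w" using l(2)[of y] by (simp add: y_def S_inv)
    also have cs: "\<dots> \<le> norm y * norm w" by (rule norm_cauchy_schwarz)
    finally have "l * norm y \<le> norm w" by (cases "y = 0") (simp_all add: power2_eq_square)
    then have "norm y \<le> norm w / l" using l by (simp add: field_simps)
    then have "norm y * norm w \<le> norm w / l * norm w" by (rule mult_right_mono) simp
    with cs show ?thesis by (simp add: y_def power2_eq_square inner_commute)
  qed
  then show ?thesis using that[of "1 / l"] l by simp
qed

text \<open>The operator \<open>S\<close> of the metric cancels \<open>inv S\<close> in the cross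
  term, leaving the plain inner product with \<open>w\<close> that the half-space inequality
  bounds.\<close>

lemma norm_wrt_update:
  "(norm_wrt S (x - t *\<^sub>R inv S w - z))\<^sup>2
    = (norm_wrt S (x - z))\<^sup>2 - 2 * t * inner w (x - z) + t * (t * inner w (inv S w))"
proof -
  define y where "y = inv S w"
  have w: "w = S y" by (simp add: y_def S_inv)
  have eq: "x - t *\<^sub>R y - z = (x - z) - t *\<^sub>R y" by simp
  have "(norm_wrt S (x - t *\<^sub>R y - z))\<^sup>2 = inner ((x - z) - t *\<^sub>R y) (S ((x - z) - t *\<^sub>R y))"
    unfolding eq by (rule norm_wrt_power2)
  also have "\<dots> = inner (x - z) (S (x - z)) - 2 * t * inner (S y) (x - z) + t * (t * inner (S y) y)"
    unfolding diff[of "x - z"] scale using symmetric[of y "x - z"]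
    by (simp add: inner_diff_left inner_diff_right inner_commute algebra_simps)
  finally show ?thesis by (simp add: y_def S_inv norm_wrt_power2)
qed

end

section \<open>Weak convergence of Fejer monotone sequences\<close>

lemma closure_convex_hull_inner_le:
  assumes "xb \<in> closure (convex hull A)" and "\<And>a. a \<in> A \<Longrightarrow> inner a y \<le> c"
  shows "inner xb y \<le> c"
proof -
  have "closure (convex hull A) \<subseteq> {a. inner y a \<le> c}"
    using assms(2)
    by (intro closure_minimal hull_minimal closed_halfspace_le convex_halfspace_le) (auto simp: inner_commute)
  then show ?thesis using assms(1) by (auto simp: inner_commute)
qed

text \<open>
  Stands in for weak cluster points: every weak limit of a subsequence \<open>x \<circ> r\<close> has this property,
  and for bounded sequences such points exist without any weak compactness theorem.
\<close>

definition hull_cluster :: "(nat \<Rightarrow> 'a::real_inner) \<Rightarrow> 'a \<Rightarrow> bool" where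
  "hull_cluster x xb \<longleftrightarrow> (\<forall>n. xb \<in> closure (convex hull (x ` {n..})))"

lemma hull_cluster_exists:
  fixes x :: "nat \<Rightarrow> 'a::{real_inner, complete_space}"
  assumes "bounded (range x)"
  shows "\<exists>xb. hull_cluster x xb"
proof -
  have "(\<Inter>n. closure (convex hull (x ` {n..}))) \<noteq> {}"
  proof (rule decseq_convex_closures_Int_nonempty)
    show "decseq (\<lambda>n. convex hull (x ` {n..}))"
      unfolding decseq_def by (intro allI impI hull_mono image_mono) auto
    show "bounded (convex hull (x ` {0..}))"
      using assms by (intro bounded_convex_hull) (simp add: atLeast_0)
  qed auto
  then show ?thesis unfolding hull_cluster_def by blast
qed

lemma hull_cluster_inner_le:
  assumes "hull_cluster x xb" "\<forall>\<^sub>F k in sequentially. inner (x k) y \<le> c"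
  shows "inner xb y \<le> c"
proof -
  obtain N where "\<And>k. N \<le> k \<Longrightarrow> inner (x k) y \<le> c" using assms(2) unfolding eventually_sequentially by blast
  then show ?thesis
    using closure_convex_hull_inner_le[of xb "x ` {N..}" y c] assms(1) unfolding hull_cluster_def by auto
qed

lemma hull_cluster_inner_le_lim:
  assumes "hull_cluster x xb" "(\<lambda>k. inner (x k) y) \<longlonglongrightarrow> c"
  shows "inner xb y \<le> c"
proof (rule field_le_epsilon)
  fix e :: real assume "0 < e"
  then have "\<forall>\<^sub>F k in sequentially. inner (x k) y < c + e" by (intro order_tendstoD(2)[OF assms(2)]) simp
  then show "inner xb y \<le> c + e"
    by (intro hull_cluster_inner_le[OF assms(1)]) (auto elim: eventually_mono)
qed

lemma hull_cluster_inner_eq_lim: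
  assumes "hull_cluster x xb" "(\<lambda>k. inner (x k) y) \<longlonglongrightarrow> c"
  shows "inner xb y = c"
proof (rule antisym)
  have "(\<lambda>k. inner (x k) (- y)) \<longlonglongrightarrow> - c" using tendsto_minus[OF assms(2)] by simp
  from hull_cluster_inner_le_lim[OF assms(1) this] show "c \<le> inner xb y" by simp
qed (rule hull_cluster_inner_le_lim[OF assms])

text \<open>Upper bounds suffice, since lower bounds are upper bounds for
  \<open>- y\<close>.\<close>

lemma weakly_convergesI:
  assumes "\<And>y a. inner xb y < a \<Longrightarrow> \<forall>\<^sub>F k in sequentially. inner (x k) y < a"
  shows "weakly_converges x xb"
  unfolding weakly_converges_def
proof (intro allI order_tendstoI)
  fix y and a
  assume "a < inner xb y"
  then have "inner xb (- y) < - a" by simp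
  from assms[OF this] show "\<forall>\<^sub>F k in sequentially. a < inner (x k) y" by simp
qed (rule assms)

context pos_def_operator
begin

lemma fejer_convergent:
  assumes "\<And>k. norm_wrt S (x (Suc k) - z) \<le> norm_wrt S (x k - z)"
  shows "convergent (\<lambda>k. norm_wrt S (x k - z))"
proof -
  have "decseq (\<lambda>k. norm_wrt S (x k - z))" using assms by (rule decseq_SucI)
  from decseq_convergent[OF this, of 0] show ?thesis
    by (meson norm_wrt_nonneg convergent_def)
qed

lemma fejer_bounded:
  assumes "\<And>k. norm_wrt S (x (Suc k) - z) \<le> norm_wrt S (x k - z)"
  shows "bounded (range x)"
proof -
  obtain m n where m: "0 < m" "\<And>y. m * norm y \<le> norm_wrt S y" using norm_wrt_equiv by metis
  have "dist z (x k) \<le> norm_wrt S (x 0 - z) / m" for k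
  proof -
    have "m * norm (x k - z) \<le> norm_wrt S (x k - z)" by (rule m)
    also have "\<dots> \<le> norm_wrt S (x 0 - z)"
      using decseq_SucI[of "\<lambda>k. norm_wrt S (x k - z)"] assms by (auto simp: decseq_def)
    finally show ?thesis using m(1) by (simp add: field_simps dist_norm norm_minus_commute)
  qed
  then show ?thesis unfolding bounded_def by blast
qed

text \<open>Cluster points in \<open>Z\<close> are unique because the pairing of \<open>x k\<close>
  with \<open>S (xb - yb)\<close> converges, so that both cluster points give it the same value. If
  weak convergence to \<open>xb\<close> failed, a subsequence confined to a half-space without
  \<open>xb\<close> would have a second cluster point.\<close>

lemma opial:
  assumes fejer: "\<And>z k. z \<in> Z \<Longrightarrow> norm_wrt S (x (Suc k) - z) \<le> norm_wrt S (x k - z)"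
    and ne: "Z \<noteq> {}"
    and cluster: "\<And>r xb. strict_mono r \<Longrightarrow> hull_cluster (x \<circ> r) xb \<Longrightarrow> xb \<in> Z"
  shows "\<exists>xb\<in>Z. weakly_converges x xb"
proof -
  have "bounded (range x)" using fejer_bounded fejer ne by blast
  then have "bounded (range (x \<circ> r))" for r :: "nat \<Rightarrow> nat" by (rule bounded_subset) auto
  then have ex: "\<exists>xb. hull_cluster (x \<circ> r) xb" for r :: "nat \<Rightarrow> nat" by (rule hull_cluster_exists)
  have conv: "convergent (\<lambda>k. inner (x k) (S (z - z')))" if z: "z \<in> Z" "z' \<in> Z" for z z'
  proof -
    \<comment> \<open>Polarization: up to constants, the pairing is a difference of two squared
      distances, each convergent by Fejer monotonicity.\<close>
    have eq: "inner (x k) (S (z - z'))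
        = (1/2) * ((norm_wrt S (x k - z'))\<^sup>2 - (norm_wrt S (x k - z))\<^sup>2 + inner z (S z) - inner z' (S z'))" for k
      using symmetric[of z "x k"] symmetric[of z' "x k"]
      by (simp add: norm_wrt_power2 diff inner_diff_left inner_diff_right inner_commute)
    obtain a b where "(\<lambda>k. norm_wrt S (x k - z)) \<longlonglongrightarrow> a" "(\<lambda>k. norm_wrt S (x k - z')) \<longlonglongrightarrow> b"
      using fejer_convergent fejer z unfolding convergent_def by metis
    then have "(\<lambda>k. (1/2) * ((norm_wrt S (x k - z'))\<^sup>2 - (norm_wrt S (x k - z))\<^sup>2 + inner z (S z) - inner z' (S z')))
        \<longlonglongrightarrow> (1/2) * (b\<^sup>2 - a\<^sup>2 + inner z (S z) - inner z' (S z'))"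
      by (intro tendsto_intros)
    then show ?thesis unfolding convergent_def eq by blast
  qed
  obtain xb where xb: "hull_cluster (x \<circ> id) xb" using ex by blast
  have xbZ: "xb \<in> Z" by (rule cluster[OF _ xb]) (simp add: strict_mono_def)
  have "weakly_converges x xb"
  proof (rule weakly_convergesI, rule ccontr)
    fix y and a :: real
    assume less: "inner xb y < a" and "\<not> (\<forall>\<^sub>F k in sequentially. inner (x k) y < a)"
    then have "\<exists>\<^sub>F k in sequentially. a \<le> inner (x k) y" by (simp add: not_eventually not_less)
    then have "infinite {k. a \<le> inner (x k) y}" by (simp add: frequently_cofinite flip: cofinite_eq_sequentially)
    from infinite_enumerate[OF this] obtain r :: "nat \<Rightarrow> nat"
      where r: "strict_mono r" "\<And>n. a \<le> inner (x (r n)) y" by auto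
    obtain yb where yb: "hull_cluster (x \<circ> r) yb" using ex by blast
    have "yb \<in> Z" by (rule cluster[OF r(1) yb])
    then obtain c where c: "(\<lambda>k. inner (x k) (S (xb - yb))) \<longlonglongrightarrow> c"
      using conv[OF xbZ] unfolding convergent_def by blast
    from LIMSEQ_subseq_LIMSEQ[OF this r(1)] have "(\<lambda>k. inner ((x \<circ> r) k) (S (xb - yb))) \<longlonglongrightarrow> c"
      by (simp add: o_def)
    then have "inner yb (S (xb - yb)) = c" by (rule hull_cluster_inner_eq_lim[OF yb])
    moreover have "inner xb (S (xb - yb)) = c" using hull_cluster_inner_eq_lim[OF xb] c by simp
    ultimately have "inner (xb - yb) (S (xb - yb)) = 0" by (simp add: inner_diff_left)
    then have "xb = yb" by (simp add: inner_self_eq_0_iff)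
    moreover have "inner yb (- y) \<le> - a"
      by (rule hull_cluster_inner_le[OF yb]) (simp add: r(2))
    ultimately show False using less by simp
  qed
  then show ?thesis using xbZ by blast
qed

end

text \<open>Finite dimension enters as a finite spanning set. After orthogonalization each vector is
  the finite sum of its coordinates, and weak convergence is convergence of these.\<close>

lemma weakly_converges_imp_tendsto:
  fixes x :: "nat \<Rightarrow> 'a::real_inner"
  assumes weak: "weakly_converges x xb" and b: "finite b" "span b = (UNIV :: 'a set)"
  shows "x \<longlonglongrightarrow> xb"
proof -
  obtain C :: "'a set" where C: "finite C" "span C = UNIV" "pairwise orthogonal C"
    using basis_orthogonal[OF b(1)] b(2) by auto
  \<comment> \<open>A zero vector in \<open>C\<close> does no harm, as its summand vanishes.\<close>
  have expand: "v = (\<Sum>c\<in>C. (inner v c / inner c c) *\<^sub>R c)" for v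
  proof -
    define h where "h = v - (\<Sum>c\<in>C. (inner v c / inner c c) *\<^sub>R c)"
    have "orthogonal h c" if c: "c \<in> C" for c
    proof -
      have "inner (\<Sum>c'\<in>C. (inner v c' / inner c' c') *\<^sub>R c') c
          = (\<Sum>c'\<in>C. if c' = c then inner v c else 0)"
        unfolding inner_sum_left
        using C(3) c by (intro sum.cong refl) (auto simp: pairwise_def orthogonal_def)
      also have "\<dots> = inner v c" using C(1) c by simp
      finally show ?thesis by (simp add: h_def orthogonal_def inner_diff_left)
    qed
    then have "orthogonal h h" using orthogonal_to_span[of h C h] C(2) by auto
    then show ?thesis by (simp add: h_def orthogonal_self)
  qed
  have "(\<lambda>k. \<Sum>c\<in>C. (inner (x k) c / inner c c) *\<^sub>R c) \<longlonglongrightarrow> (\<Sum>c\<in>C. (inner xb c / inner c c) *\<^sub>R c)"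
    using weak unfolding weakly_converges_def
    by (intro tendsto_sum tendsto_scaleR tendsto_const) (simp add: divide_inverse tendsto_mult_right)
  then show ?thesis unfolding expand[symmetric] .
qed

section \<open>One step of the iteration\<close>

text \<open>
  The relaxed projection step: \<open>P\<close> is \<open>inner w (x - z)\<close>, \<open>N\<close> its lower bound from monotonicity, \<open>W\<close> the
  squared dual norm of \<open>w\<close>, and \<open>d\<close> the squared residual. In case \<open>W = 0\<close> the quotient is \<open>0\<close>.
\<close>

lemma relaxed_projection_decrease:
  fixes P N W d \<theta> \<mu> e c C :: real
  assumes "0 < e" "e \<le> \<theta>" "\<theta> \<le> 2 - e" "0 < c" "0 < C" "0 \<le> d"
    and N: "c * d \<le> N" "N \<le> P" and W: "0 \<le> W" "W \<le> C * d" "W = 0 \<Longrightarrow> d = 0"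
    and \<mu>: "\<mu> = N / W"
  shows "- 2 * (\<theta> * \<mu>) * P + \<theta> * \<mu> * (\<theta> * \<mu> * W) \<le> - (e\<^sup>2 * (c\<^sup>2 / C)) * d"
proof (cases "W = 0")
  case True
  then show ?thesis using W \<mu> by simp
next
  case False
  then have Wpos: "0 < W" using W by simp
  have N0: "0 \<le> N" using N(1) assms(4,6) by (meson mult_nonneg_nonneg less_imp_le order_trans)
  have \<mu>0: "0 \<le> \<mu>" using N0 Wpos \<mu> by simp
  have \<mu>W: "\<mu> * W = N" using Wpos \<mu> by simp
  \<comment> \<open>The gain of the step is \<open>\<mu> * N\<close>, that is,
    \<open>N\<^sup>2 / W\<close>; the bounds on \<open>N\<close> and \<open>W\<close> turn it into a
    multiple of \<open>d\<close>. Multiplying by \<open>W\<close> avoids the division.\<close>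
  have "c\<^sup>2 / C * d * W \<le> c\<^sup>2 / C * d * (C * d)"
    using W assms(4,5,6) by (intro mult_left_mono) auto
  also have "\<dots> = (c * d)\<^sup>2" using assms(5) by (simp add: power2_eq_square)
  also have "\<dots> \<le> N\<^sup>2" using N(1) assms(4,6) by (intro power_mono) auto
  also have "\<dots> = \<mu> * N * W" using \<mu>W by (simp add: power2_eq_square algebra_simps)
  finally have 1: "c\<^sup>2 / C * d \<le> \<mu> * N" using Wpos by (rule mult_right_le_imp_le)
  have "e * e \<le> \<theta> * (2 - \<theta>)" using assms(1-3) by (intro mult_mono) auto
  then have "e\<^sup>2 * (c\<^sup>2 / C * d) \<le> \<theta> * (2 - \<theta>) * (\<mu> * N)"
    unfolding power2_eq_square[of e] using assms(4-6)
    by (intro mult_mono[OF _ 1] mult_nonneg_nonneg) (use \<open>e * e \<le> \<theta> * (2 - \<theta>)\<close> assms(1-3) in auto)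
  moreover have "\<theta> * \<mu> * N \<le> \<theta> * \<mu> * P"
    using N(2) \<mu>0 assms(1,2) by (intro mult_left_mono) auto
  moreover have eq: "\<theta> * \<mu> * (\<theta> * \<mu> * W) = \<theta> * \<theta> * (\<mu> * N)"
    unfolding \<mu>W[symmetric] by (simp only: ac_simps)
  ultimately show ?thesis unfolding eq by (simp add: algebra_simps)
qed

section \<open>Estimates for the operators of the splitting\<close>

locale splitting = pos_def_operator S
  for S :: "'a::{real_inner, complete_space} \<Rightarrow> 'a" +
  fixes B :: "'a \<Rightarrow> 'a set" and D E K :: "'a \<Rightarrow> 'a" and L \<beta> :: real
  assumes L: "0 \<le> L" and \<beta>: "0 \<le> \<beta>"
    and D: "lipschitz_on L UNIV D" and E: "recip_cocoercive \<beta> E" and K: "linear_skew_adjoint K"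
    and BD: "maximally_monotone (\<lambda>z. B z + {D z})"
begin

abbreviation F :: "'a \<Rightarrow> 'a set" where "F \<equiv> \<lambda>z. B z + {D z} + {E z} + {K z}"

lemma mem_BD_iff: "u \<in> B z + {D z} \<longleftrightarrow> u - D z \<in> B z"
  by (auto simp: set_plus_def) (metis diff_add_cancel)

lemma mem_F_iff: "u \<in> F z \<longleftrightarrow> u - E z - K z \<in> B z + {D z}"
  unfolding mem_BD_iff by (force simp: set_plus_def algebra_simps)

lemma zer_F_iff: "z \<in> zer F \<longleftrightarrow> - E z - K z \<in> B z + {D z}"
  unfolding zer_def mem_Collect_eq mem_F_iff by simp

lemma BD_mono: "u \<in> B x + {D x} \<Longrightarrow> v \<in> B y + {D y} \<Longrightarrow> 0 \<le> inner (u - v) (x - y)"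
  using BD unfolding maximally_monotone_def monotone_op_def by blast

lemma D_lipschitz: "norm (D x - D y) \<le> L * norm (x - y)"
  using lipschitz_onD[OF D, of x y] by (simp add: dist_norm)

lemma K_bounded_linear: "bounded_linear K"
  using K by (simp add: linear_skew_adjoint_def)

lemma K_skew: "inner (K x) x = 0"
proof -
  have "inner (K x) x = inner x (- K x)"
    using adjoint_works_hilbert[OF K_bounded_linear, of x x] K by (simp add: linear_skew_adjoint_def)
  then show ?thesis by (simp add: inner_commute)
qed

lemma K_diff: "K (x - y) = K x - K y"
  by (rule linear_diff[OF bounded_linear.linear[OF K_bounded_linear]])

text \<open>Cocoercivity at \<open>x\<close> and \<open>z\<close> pays for replacing
  \<open>x - z\<close> by \<open>y - z\<close>, after completing a square. This is the source of the
  term with \<open>\<beta> / 4\<close> in the numerator of the step length.\<close>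

lemma cocoercive_lower_bound: "- (\<beta> / 4) * (norm (x - y))\<^sup>2 \<le> inner (E x - E z) (y - z)"
proof (cases "\<beta> = 0")
  case True
  then obtain c where "\<And>x. E x = c" using E unfolding recip_cocoercive_def by auto
  then show ?thesis using True by simp
next
  case False
  then have pos: "0 < \<beta>" using \<beta> by simp
  define a b where "a = norm (E x - E z)" and "b = norm (x - y)"
  have "1 / \<beta> * a\<^sup>2 \<le> inner (E x - E z) (x - z)"
    using E False unfolding recip_cocoercive_def a_def by auto
  moreover have "inner (E x - E z) (x - y) \<le> a * b" unfolding a_def b_def by (rule norm_cauchy_schwarz)
  moreover have "0 \<le> 1 / \<beta> * (a - \<beta> / 2 * b)\<^sup>2" using pos by simp
  moreover have "1 / \<beta> * (a - \<beta> / 2 * b)\<^sup>2 = 1 / \<beta> * a\<^sup>2 - a * b + \<beta> / 4 * b\<^sup>2"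
    using pos by (simp add: power2_eq_square field_simps)
  moreover have "inner (E x - E z) (y - z) = inner (E x - E z) (x - z) - inner (E x - E z) (x - y)"
    by (simp add: inner_simps)
  ultimately show ?thesis unfolding b_def[symmetric] by linarith
qed

lemma E_lipschitz: "norm (E x - E y) \<le> \<beta> * norm (x - y)"
proof (cases "\<beta> = 0")
  case True
  then obtain c where "\<And>x. E x = c" using E unfolding recip_cocoercive_def by auto
  then show ?thesis using True by simp
next
  case False
  then have pos: "0 < \<beta>" using \<beta> by simp
  have "1 / \<beta> * (norm (E x - E y))\<^sup>2 \<le> inner (E x - E y) (x - y)"
    using E False unfolding recip_cocoercive_def by auto
  also have "\<dots> \<le> norm (E x - E y) * norm (x - y)" by (rule norm_cauchy_schwarz)
  finally show ?thesis using pos by (cases "E x = E y") (simp_all add: power2_eq_square field_simps)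
qed

text \<open>Skewness removes \<open>K\<close>, and \<open>E\<close> is monotone by the previous
  bound with both of its first two points equal.\<close>

lemma F_mono:
  assumes "u \<in> F x" "v \<in> F y"
  shows "0 \<le> inner (u - v) (x - y)"
proof -
  have "0 \<le> inner ((u - E x - K x) - (v - E y - K y)) (x - y)"
    using assms unfolding mem_F_iff by (rule BD_mono)
  also have "\<dots> = inner (u - v) (x - y) - inner (E x - E y) (x - y) - inner (K (x - y)) (x - y)"
    by (simp add: K_diff inner_diff_left)
  finally show ?thesis using cocoercive_lower_bound[of x x y] by (simp add: K_skew)
qed

text \<open>The hypothesis says that \<open>(x, 0)\<close> is monotonically related to the graph of
  \<open>F\<close>. Maximality of \<open>F\<close> is used in the form of solvability: with
  \<open>v \<in> F y\<close> and \<open>y + \<tau> *\<^sub>R v = x\<close>, the hypothesis forces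
  \<open>v = 0\<close>.\<close>

lemma zer_F_memI:
  assumes le: "\<And>y v. v \<in> F y \<Longrightarrow> inner v x \<le> inner v y"
  shows "x \<in> zer F"
proof -
  obtain k where k: "0 < k" "\<And>x. norm (K x) \<le> norm x * k"
    using bounded_linear.pos_bounded[OF K_bounded_linear] by blast
  \<comment> \<open>Small enough for \<open>E + K\<close>, with Lipschitz constant
    \<open>\<beta> + k\<close>, to be an admissible perturbation.\<close>
  define \<tau> where "\<tau> = 1 / (\<beta> + k + 1)"
  have \<tau>: "0 < \<tau>" "\<tau> * (\<beta> + k) < 1" using k \<beta> by (simp_all add: \<tau>_def)
  have lip: "norm ((E x + K x) - (E y + K y)) \<le> (\<beta> + k) * norm (x - y)" for x y
  proof -
    have "norm ((E x + K x) - (E y + K y)) \<le> norm (E x - E y) + norm (K (x - y))"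
      using norm_triangle_ineq[of "E x - E y" "K (x - y)"] by (simp add: K_diff algebra_simps)
    then show ?thesis using E_lipschitz[of x y] k(2)[of "x - y"] by (simp add: algebra_simps)
  qed
  obtain y a where a: "a \<in> B y + {D y}" and y: "y + \<tau> *\<^sub>R (a + (E y + K y)) = x"
    using maximally_monotone_add_lipschitz_surj[OF BD \<tau>(1) lip _ \<tau>(2), of x] \<beta> k(1) by auto
  define v where "v = a + (E y + K y)"
  have v: "v \<in> F y" using a unfolding mem_F_iff v_def by simp
  have "inner v (y + \<tau> *\<^sub>R v) \<le> inner v y" using le[OF v] y by (simp add: v_def)
  then have "\<tau> * inner v v \<le> 0" by (simp add: inner_simps)
  then have "v = 0" using \<tau>(1) inner_ge_zero[of v] by (simp add: mult_le_0_iff)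
  then show ?thesis using v y by (simp add: zer_def v_def)
qed

text \<open>Only \<open>B + D\<close> is assumed monotone, so the inclusion is read as one for
  \<open>B + D\<close> perturbed by \<open>- D\<close>. As \<open>\<gamma> * L < 1\<close>, a
  solution exists by the perturbation result and is unique by strong monotonicity; the set under
  \<open>the_elem\<close> is thus a singleton.\<close>

lemma resolvent_mem:
  assumes \<gamma>: "0 < \<gamma>" "\<gamma> * L < 1"
    and y: "y = the_elem (op_inverse (\<lambda>z. {z} + (\<lambda>u. \<gamma> *\<^sub>R u) ` B z) p)"
  shows "inverse \<gamma> *\<^sub>R (p - y) \<in> B y"
proof -
  have iff: "z \<in> op_inverse (\<lambda>z. {z} + (\<lambda>u. \<gamma> *\<^sub>R u) ` B z) p \<longleftrightarrow> inverse \<gamma> *\<^sub>R (p - z) \<in> B z" for z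
  proof -
    have eq: "p = z + \<gamma> *\<^sub>R b \<longleftrightarrow> b = inverse \<gamma> *\<^sub>R (p - z)" for b
    proof
      assume "b = inverse \<gamma> *\<^sub>R (p - z)"
      then show "p = z + \<gamma> *\<^sub>R b" using \<gamma>(1) by simp
    qed (use \<gamma>(1) in simp)
    have "z \<in> op_inverse (\<lambda>z. {z} + (\<lambda>u. \<gamma> *\<^sub>R u) ` B z) p \<longleftrightarrow> (\<exists>b\<in>B z. p = z + \<gamma> *\<^sub>R b)"
      by (auto simp: op_inverse_def set_plus_def)
    then show ?thesis unfolding eq by blast
  qed
  obtain z a where a: "a \<in> B z + {D z}" and z: "z + \<gamma> *\<^sub>R (a + - D z) = p"
    using maximally_monotone_add_lipschitz_surj[OF BD \<gamma>(1) _ L \<gamma>(2), of "\<lambda>x. - D x" p] D_lipschitz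
    by (auto simp: norm_minus_commute)
  have "inverse \<gamma> *\<^sub>R (p - z) = a - D z" unfolding z[symmetric] using \<gamma>(1) by simp
  then have z_mem: "inverse \<gamma> *\<^sub>R (p - z) \<in> B z" using a by (simp add: mem_BD_iff)
  have "z' = z" if z': "inverse \<gamma> *\<^sub>R (p - z') \<in> B z'" for z'
  proof -
    have "0 \<le> inner ((inverse \<gamma> *\<^sub>R (p - z') + D z') - (inverse \<gamma> *\<^sub>R (p - z) + D z)) (z' - z)"
      by (rule BD_mono) (simp_all add: mem_BD_iff z' z_mem)
    also have "\<dots> = inner (D z' - D z) (z' - z) - inverse \<gamma> * (norm (z' - z))\<^sup>2"
      by (simp add: power2_norm_eq_inner inner_simps algebra_simps)
    also have "inner (D z' - D z) (z' - z) \<le> norm (D z' - D z) * norm (z' - z)" by (rule norm_cauchy_schwarz)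
    also have "\<dots> \<le> L * norm (z' - z) * norm (z' - z)" by (intro mult_right_mono D_lipschitz) simp
    finally have "0 \<le> (L - inverse \<gamma>) * (norm (z' - z))\<^sup>2" by (simp add: power2_eq_square algebra_simps)
    moreover have "L - inverse \<gamma> < 0" using \<gamma> by (simp add: field_simps)
    ultimately have "(norm (z' - z))\<^sup>2 \<le> 0" by (simp add: zero_le_mult_iff)
    then show ?thesis by simp
  qed
  then have "op_inverse (\<lambda>z. {z} + (\<lambda>u. \<gamma> *\<^sub>R u) ` B z) p = {z}" using iff z_mem by blast
  then show ?thesis using y z_mem by simp
qed

text \<open>The forward step evaluates \<open>E\<close> at \<open>x\<close>, while
  \<open>F xh\<close> needs it at \<open>xh\<close>; hence the correction
  \<open>E x - E xh\<close>.\<close>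

lemma residual_mem_F:
  assumes \<gamma>: "0 < \<gamma>" "\<gamma> * L < 1"
    and xh: "xh = the_elem (op_inverse (\<lambda>z. {z} + (\<lambda>u. \<gamma> *\<^sub>R u) ` B z) (x - \<gamma> *\<^sub>R (D x + K x + E x)))"
  shows "(inverse \<gamma> *\<^sub>R x - D x - K x) - (inverse \<gamma> *\<^sub>R xh - D xh - K xh) - (E x - E xh) \<in> F xh"
proof -
  have "inverse \<gamma> *\<^sub>R (x - \<gamma> *\<^sub>R (D x + K x + E x) - xh) \<in> B xh"
    by (rule resolvent_mem[OF \<gamma> xh])
  moreover have "inverse \<gamma> *\<^sub>R (x - \<gamma> *\<^sub>R (D x + K x + E x) - xh)
      = (inverse \<gamma> *\<^sub>R x - D x - K x) - (inverse \<gamma> *\<^sub>R xh - D xh - K xh) - (E x - E xh) - E xh - K xh - D xh"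
    using \<gamma>(1) by (simp add: algebra_simps)
  ultimately show ?thesis unfolding mem_F_iff mem_BD_iff by simp
qed

text \<open>Pairing the elements of \<open>B + D\<close> at \<open>xh\<close> and \<open>z\<close>
  cancels \<open>E xh\<close>, leaving \<open>E x - E z\<close> tested against
  \<open>xh - z\<close>, which is the three-point form of the cocoercivity bound.\<close>

lemma separation:
  assumes "w - (E x - E xh) \<in> F xh" "z \<in> zer F"
  shows "inner w (x - xh) - \<beta> / 4 * (norm (x - xh))\<^sup>2 \<le> inner w (x - z)"
proof -
  have "0 \<le> inner ((w - (E x - E xh) - E xh - K xh) - (- E z - K z)) (xh - z)"
    using assms unfolding mem_F_iff zer_F_iff by (rule BD_mono)
  also have "\<dots> = inner w (xh - z) - inner (E x - E z) (xh - z) - inner (K (xh - z)) (xh - z)"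
    by (simp add: K_diff inner_diff_left)
  finally have "inner (E x - E z) (xh - z) \<le> inner w (xh - z)" by (simp add: K_skew)
  then show ?thesis using cocoercive_lower_bound[of x xh z] by (simp add: inner_diff_right)
qed

lemma kernel_strongly_monotone:
  "(inverse \<gamma> - L) * (norm (x - y))\<^sup>2
    \<le> inner ((inverse \<gamma> *\<^sub>R x - D x - K x) - (inverse \<gamma> *\<^sub>R y - D y - K y)) (x - y)"
proof -
  have "inner (D x - D y) (x - y) \<le> norm (D x - D y) * norm (x - y)" by (rule norm_cauchy_schwarz)
  also have "\<dots> \<le> L * norm (x - y) * norm (x - y)" by (intro mult_right_mono D_lipschitz) simp
  finally have "inner (D x - D y) (x - y) \<le> L * (norm (x - y))\<^sup>2" by (simp add: power2_eq_square)
  moreover have "inner ((inverse \<gamma> *\<^sub>R x - D x - K x) - (inverse \<gamma> *\<^sub>R y - D y - K y)) (x - y)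
      = inverse \<gamma> * (norm (x - y))\<^sup>2 - inner (D x - D y) (x - y) - inner (K (x - y)) (x - y)"
    unfolding K_diff power2_norm_eq_inner by (simp add: inner_simps inner_commute algebra_simps)
  ultimately show ?thesis by (simp add: K_skew left_diff_distrib)
qed

lemma kernel_lipschitz:
  assumes "\<And>x. norm (K x) \<le> norm x * k" "0 < \<gamma>"
  shows "norm ((inverse \<gamma> *\<^sub>R x - D x - K x) - (inverse \<gamma> *\<^sub>R y - D y - K y)) \<le> (inverse \<gamma> + L + k) * norm (x - y)"
proof -
  have eq: "(inverse \<gamma> *\<^sub>R x - D x - K x) - (inverse \<gamma> *\<^sub>R y - D y - K y)
      = inverse \<gamma> *\<^sub>R (x - y) - (D x - D y) - K (x - y)"
    by (simp add: K_diff algebra_simps)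
  have "norm (inverse \<gamma> *\<^sub>R (x - y) - (D x - D y) - K (x - y))
      \<le> norm (inverse \<gamma> *\<^sub>R (x - y)) + norm (D x - D y) + norm (K (x - y))"
    by (meson add_mono norm_triangle_ineq4 order_refl order_trans)
  also have "\<dots> \<le> inverse \<gamma> * norm (x - y) + L * norm (x - y) + norm (x - y) * k"
    using D_lipschitz[of x y] assms by (intro add_mono) auto
  finally show ?thesis unfolding eq by (simp add: algebra_simps)
qed

text \<open>The constants \<open>C\<close> and \<open>q\<close> are fixed before the step
  parameters, so that they serve all iterations at once.\<close>

lemma iteration_step:
  fixes \<epsilon> e :: real
  assumes \<epsilon>: "0 < \<epsilon>" "\<epsilon> < 1" and e: "0 < e"
  obtains C q where "0 < C" "0 < q"
    and "\<And>\<gamma> \<theta> \<mu> x xh w. \<epsilon> \<le> \<gamma> \<Longrightarrow> \<gamma> \<le> 1 / \<epsilon> \<Longrightarrow> (\<beta> + 4 * L \<noteq> 0 \<Longrightarrow> \<gamma> \<le> (4 - \<epsilon>) / (\<beta> + 4 * L))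
      \<Longrightarrow> e \<le> \<theta> \<Longrightarrow> \<theta> \<le> 2 - e
      \<Longrightarrow> xh = the_elem (op_inverse (\<lambda>z. {z} + (\<lambda>u. \<gamma> *\<^sub>R u) ` B z) (x - \<gamma> *\<^sub>R (D x + K x + E x)))
      \<Longrightarrow> w = (inverse \<gamma> *\<^sub>R x - D x - K x) - (inverse \<gamma> *\<^sub>R xh - D xh - K xh)
      \<Longrightarrow> \<mu> = (inner w (x - xh) - \<beta> / 4 * (norm (x - xh))\<^sup>2) / (norm_wrt (inv S) w)\<^sup>2
      \<Longrightarrow> norm w \<le> C * norm (x - xh) \<and> w - (E x - E xh) \<in> F xh
        \<and> (\<forall>z\<in>zer F. (norm_wrt S (x - (\<theta> * \<mu>) *\<^sub>R inv S w - z))\<^sup>2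
              \<le> (norm_wrt S (x - z))\<^sup>2 - q * (norm (x - xh))\<^sup>2)"
proof -
  obtain k where k: "0 < k" "\<And>x. norm (K x) \<le> norm x * k"
    using bounded_linear.pos_bounded[OF K_bounded_linear] by blast
  obtain u where u: "0 < u" "\<And>w. inner w (inv S w) \<le> u * (norm w)\<^sup>2" using inner_inv_le by blast
  \<comment> \<open>Bounds the Lipschitz constant of the kernel, as \<open>inverse \<gamma>\<close>
    is at most \<open>1 / \<epsilon>\<close>.\<close>
  define C where "C = 1 / \<epsilon> + L + k"
  \<comment> \<open>Both \<open>inverse \<gamma>\<close> and
    \<open>4 - \<gamma> * (\<beta> + 4 * L)\<close> are at least \<open>\<epsilon>\<close>, and
    their product is four times the modulus
    \<open>inverse \<gamma> - L - \<beta> / 4\<close>.\<close>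
  define c where "c = \<epsilon>\<^sup>2 / 4"
  define q where "q = e\<^sup>2 * (c\<^sup>2 / (u * C\<^sup>2))"
  have C: "0 < C" using \<epsilon> L k by (simp add: C_def add_pos_pos add_pos_nonneg)
  have c: "0 < c" using \<epsilon> by (simp add: c_def)
  have q: "0 < q" using e c u C by (simp add: q_def)
  show ?thesis
  proof (rule that[OF C q])
    fix \<gamma> \<theta> \<mu> x xh w
    assume \<gamma>: "\<epsilon> \<le> \<gamma>" "\<gamma> \<le> 1 / \<epsilon>" "\<beta> + 4 * L \<noteq> 0 \<Longrightarrow> \<gamma> \<le> (4 - \<epsilon>) / (\<beta> + 4 * L)"
      and \<theta>: "e \<le> \<theta>" "\<theta> \<le> 2 - e"
      and xh: "xh = the_elem (op_inverse (\<lambda>z. {z} + (\<lambda>u. \<gamma> *\<^sub>R u) ` B z) (x - \<gamma> *\<^sub>R (D x + K x + E x)))"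
      and w: "w = (inverse \<gamma> *\<^sub>R x - D x - K x) - (inverse \<gamma> *\<^sub>R xh - D xh - K xh)"
      and \<mu>: "\<mu> = (inner w (x - xh) - \<beta> / 4 * (norm (x - xh))\<^sup>2) / (norm_wrt (inv S) w)\<^sup>2"
    have \<gamma>0: "0 < \<gamma>" using \<epsilon> \<gamma> by simp
    have \<gamma>\<beta>: "\<gamma> * (\<beta> + 4 * L) \<le> 4 - \<epsilon>"
    proof (cases "\<beta> + 4 * L = 0")
      case True
      then show ?thesis using \<epsilon> by simp
    next
      case False
      then have "0 < \<beta> + 4 * L" using \<beta> L by simp
      then show ?thesis using \<gamma>(3)[OF False] by (simp add: pos_le_divide_eq)
    qed
    have "0 \<le> \<gamma> * \<beta>" using \<gamma>0 \<beta> by simp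
    then have \<gamma>L: "\<gamma> * L < 1" using \<gamma>\<beta> \<epsilon> by (simp add: distrib_left)
    have inv\<gamma>: "\<epsilon> \<le> inverse \<gamma>" "inverse \<gamma> \<le> 1 / \<epsilon>"
      using \<gamma> \<gamma>0 \<epsilon> by (simp_all add: field_simps)
    have "c \<le> inverse \<gamma> - L - \<beta> / 4"
    proof -
      have "\<epsilon> * \<epsilon> \<le> inverse \<gamma> * (4 - \<gamma> * (\<beta> + 4 * L))"
        using inv\<gamma> \<gamma>0 \<gamma>\<beta> \<epsilon> by (intro mult_mono) auto
      also have "\<dots> = 4 * (inverse \<gamma> - L - \<beta> / 4)" using \<gamma>0 by (simp add: field_simps)
      finally show ?thesis by (simp add: c_def power2_eq_square)
    qed
    then have "c * (norm (x - xh))\<^sup>2 \<le> (inverse \<gamma> - L - \<beta> / 4) * (norm (x - xh))\<^sup>2"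
      by (rule mult_right_mono) simp
    also have "\<dots> \<le> inner w (x - xh) - \<beta> / 4 * (norm (x - xh))\<^sup>2"
      using kernel_strongly_monotone[of \<gamma> x xh] unfolding w by (simp add: algebra_simps)
    finally have N: "c * (norm (x - xh))\<^sup>2 \<le> inner w (x - xh) - \<beta> / 4 * (norm (x - xh))\<^sup>2" .
    have "norm w \<le> (inverse \<gamma> + L + k) * norm (x - xh)"
      unfolding w by (rule kernel_lipschitz[OF k(2) \<gamma>0])
    also have "\<dots> \<le> C * norm (x - xh)"
      using inv\<gamma> by (intro mult_right_mono) (auto simp: C_def)
    finally have w_le: "norm w \<le> C * norm (x - xh)" .
    have mem: "w - (E x - E xh) \<in> F xh"
      unfolding w by (rule residual_mem_F[OF \<gamma>0 \<gamma>L xh])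
    have W_le: "inner w (inv S w) \<le> u * C\<^sup>2 * (norm (x - xh))\<^sup>2"
    proof -
      have "(norm w)\<^sup>2 \<le> (C * norm (x - xh))\<^sup>2" using w_le by (intro power_mono) auto
      then have "u * (norm w)\<^sup>2 \<le> u * (C * norm (x - xh))\<^sup>2" using u(1) by simp
      then show ?thesis using u(2)[of w] by (simp add: power_mult_distrib)
    qed
    have W0: "0 \<le> inner w (inv S w)" unfolding norm_wrt_inv_power2[symmetric] by simp
    \<comment> \<open>A vanishing denominator means \<open>w = 0\<close>, and the lower bound on the
      numerator then leaves no residual.\<close>
    have W_eq_0: "(norm (x - xh))\<^sup>2 = 0" if "inner w (inv S w) = 0"
    proof -
      have "w = 0" using that inner_inv_pos[of w] by auto
      then have "(c + \<beta> / 4) * (norm (x - xh))\<^sup>2 \<le> 0" using N by (simp add: algebra_simps)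
      then show ?thesis using c \<beta> by (simp add: mult_le_0_iff)
    qed
    have "(norm_wrt S (x - (\<theta> * \<mu>) *\<^sub>R inv S w - z))\<^sup>2 \<le> (norm_wrt S (x - z))\<^sup>2 - q * (norm (x - xh))\<^sup>2"
      if z: "z \<in> zer F" for z
    proof -
      have "- 2 * (\<theta> * \<mu>) * inner w (x - z) + \<theta> * \<mu> * (\<theta> * \<mu> * inner w (inv S w))
          \<le> - (e\<^sup>2 * (c\<^sup>2 / (u * C\<^sup>2))) * (norm (x - xh))\<^sup>2"
        using W_eq_0 \<mu>[unfolded norm_wrt_inv_power2] u(1) C
        by (intro relaxed_projection_decrease[OF e \<theta> c _ _ N separation[OF mem z] W0 W_le]) auto
      then show ?thesis unfolding norm_wrt_update q_def by (simp add: mult.assoc)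
    qed
    then show "norm w \<le> C * norm (x - xh) \<and> w - (E x - E xh) \<in> F xh
        \<and> (\<forall>z\<in>zer F. (norm_wrt S (x - (\<theta> * \<mu>) *\<^sub>R inv S w - z))\<^sup>2
              \<le> (norm_wrt S (x - z))\<^sup>2 - q * (norm (x - xh))\<^sup>2)"
      using w_le mem by blast
  qed
qed

end

section \<open>Convergence\<close>

context pos_def_operator
begin

text \<open>Real counterpart of \<open>dist_wrt\<close>, suited to subtraction and squares; it is
  used for nonempty \<open>Z\<close>, where the two agree.\<close>

definition rdist :: "'a \<Rightarrow> 'a set \<Rightarrow> real" where
  "rdist p Z = (INF z\<in>Z. norm_wrt S (p - z))"

lemma rdist_le: "z \<in> Z \<Longrightarrow> rdist p Z \<le> norm_wrt S (p - z)"
  unfolding rdist_def by (rule cINF_lower) (auto intro: bdd_belowI[of _ 0] simp: norm_wrt_nonneg)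

lemma rdist_greatest: "Z \<noteq> {} \<Longrightarrow> (\<And>z. z \<in> Z \<Longrightarrow> c \<le> norm_wrt S (p - z)) \<Longrightarrow> c \<le> rdist p Z"
  unfolding rdist_def by (rule cINF_greatest)

lemma rdist_nonneg: "Z \<noteq> {} \<Longrightarrow> 0 \<le> rdist p Z"
  by (rule rdist_greatest) (auto simp: norm_wrt_nonneg)

lemma rdist_triangle:
  assumes "Z \<noteq> {}"
  shows "rdist p Z \<le> norm_wrt S (p - p') + rdist p' Z"
proof -
  have "rdist p Z - norm_wrt S (p - p') \<le> rdist p' Z"
  proof (rule rdist_greatest[OF assms])
    fix z assume "z \<in> Z"
    then show "rdist p Z - norm_wrt S (p - p') \<le> norm_wrt S (p' - z)"
      using rdist_le[of z Z p] norm_wrt_triangle[of "p - p'" "p' - z"] by simp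
  qed
  then show ?thesis by simp
qed

lemma dist_wrt_eq_rdist:
  assumes "Z \<noteq> {}"
  shows "dist_wrt S p Z = ennreal (rdist p Z)"
proof (rule antisym)
  show "ennreal (rdist p Z) \<le> dist_wrt S p Z"
    unfolding dist_wrt_def by (intro INF_greatest ennreal_leI rdist_le)
  show "dist_wrt S p Z \<le> ennreal (rdist p Z)"
  proof (rule ennreal_le_epsilon)
    fix e :: real assume e: "0 < e"
    then obtain z where z: "z \<in> Z" "norm_wrt S (p - z) < rdist p Z + e"
      using rdist_greatest[OF assms, of "rdist p Z + e" p] by fastforce
    have "dist_wrt S p Z \<le> ennreal (norm_wrt S (p - z))"
      unfolding dist_wrt_def by (rule INF_lower[OF z(1)])
    also have "\<dots> \<le> ennreal (rdist p Z + e)" using z(2) by (intro ennreal_leI) simp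
    finally show "dist_wrt S p Z \<le> ennreal (rdist p Z) + ennreal e"
      using rdist_nonneg[OF assms] e by (simp add: ennreal_plus)
  qed
qed

text \<open>All iterates from \<open>x k\<close> on stay in the ball around \<open>z\<close> through
  \<open>x k\<close>, so they and their limit are within its diameter of \<open>x k\<close>; then
  take the infimum over \<open>z\<close>.\<close>

lemma fejer_limit_le_rdist:
  assumes fejer: "\<And>z k. z \<in> Z \<Longrightarrow> norm_wrt S (x (Suc k) - z) \<le> norm_wrt S (x k - z)"
    and ne: "Z \<noteq> {}" and lim: "x \<longlonglongrightarrow> xb"
  shows "norm_wrt S (x k - xb) \<le> 2 * rdist (x k) Z"
proof -
  have "norm_wrt S (x k - xb) / 2 \<le> rdist (x k) Z"
  proof (rule rdist_greatest[OF ne])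
    fix z assume z: "z \<in> Z"
    obtain m n where n: "\<And>y. norm_wrt S y \<le> n * norm y" using norm_wrt_equiv by metis
    have "norm_wrt S (x k - xb) \<le> 2 * norm_wrt S (x k - z) + n * norm (x m - xb)" if "k \<le> m" for m
    proof -
      have "norm_wrt S (x m - z) \<le> norm_wrt S (x k - z)"
        using decseq_SucI[of "\<lambda>k. norm_wrt S (x k - z)"] fejer z that by (auto simp: decseq_def)
      moreover have "norm_wrt S (x k - xb) \<le> norm_wrt S (x k - z) + norm_wrt S (z - x m) + norm_wrt S (x m - xb)"
        using norm_wrt_triangle[of "x k - z" "z - x m"] norm_wrt_triangle[of "x k - x m" "x m - xb"] by simp
      moreover have "norm_wrt S (z - x m) = norm_wrt S (x m - z)"
        using norm_wrt_minus[of "x m - z"] by simp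
      ultimately show ?thesis using n[of "x m - xb"] by linarith
    qed
    moreover have "(\<lambda>m. norm (x m - xb)) \<longlonglongrightarrow> 0" using lim by (simp add: LIM_zero tendsto_norm_zero)
    then have "(\<lambda>m. 2 * norm_wrt S (x k - z) + n * norm (x m - xb)) \<longlonglongrightarrow> 2 * norm_wrt S (x k - z) + n * 0"
      by (intro tendsto_intros)
    ultimately have "norm_wrt S (x k - xb) \<le> 2 * norm_wrt S (x k - z) + n * 0"
      using LIMSEQ_le_const by blast
    then show "norm_wrt S (x k - xb) / 2 \<le> norm_wrt S (x k - z)" by simp
  qed
  then show ?thesis by simp
qed

text \<open>Taking the infimum over \<open>z\<close> in the decrease and inserting the error bound
  shrinks the squared distance by the factor \<open>1 - q / \<kappa>\<^sup>2\<close>. The limit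
  inherits the rate through the preceding lemma.\<close>

lemma fejer_error_bound_linear_rate:
  assumes dec: "\<And>z k. z \<in> Z \<Longrightarrow> (norm_wrt S (x (Suc k) - z))\<^sup>2 \<le> (norm_wrt S (x k - z))\<^sup>2 - q * (r k)\<^sup>2"
    and ne: "Z \<noteq> {}" and q: "0 < q" and lim: "x \<longlonglongrightarrow> xb"
    and r: "\<And>k. 0 \<le> r k" and bound: "\<And>k. K0 \<le> k \<Longrightarrow> rdist (x k) Z \<le> \<kappa> * r k" and \<kappa>: "0 < \<kappa>"
  shows "locally_R_linear S x xb \<and> locally_Q_linear_to_zero (\<lambda>k. dist_wrt S (x k) Z)"
proof -
  \<comment> \<open>The floor \<open>1/2\<close> keeps \<open>c\<close> positive, as the R-linear
    constant divides by \<open>c ^ K0\<close>.\<close>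
  define c where "c = sqrt (max (1/2) (1 - q / \<kappa>\<^sup>2))"
  have "0 < q / \<kappa>\<^sup>2" using q \<kappa> by simp
  then have "max (1/2) (1 - q / \<kappa>\<^sup>2) < 1" "0 < max (1/2) (1 - q / \<kappa>\<^sup>2)" by auto
  then have c: "0 < c" "c < 1" unfolding c_def by (simp_all only: real_sqrt_gt_zero real_sqrt_lt_1_iff)
  have step: "rdist (x (Suc k)) Z \<le> c * rdist (x k) Z" if k: "K0 \<le> k" for k
  proof -
    \<comment> \<open>The square root puts the bound in the form of a lower bound on each distance,
      so that it passes to the infimum.\<close>
    have "sqrt ((rdist (x (Suc k)) Z)\<^sup>2 + q * (r k)\<^sup>2) \<le> rdist (x k) Z"
    proof (rule rdist_greatest[OF ne])
      fix z assume z: "z \<in> Z"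
      have "(rdist (x (Suc k)) Z)\<^sup>2 \<le> (norm_wrt S (x (Suc k) - z))\<^sup>2"
        using rdist_le[OF z] rdist_nonneg[OF ne] by (intro power_mono)
      then have "(rdist (x (Suc k)) Z)\<^sup>2 + q * (r k)\<^sup>2 \<le> (norm_wrt S (x k - z))\<^sup>2"
        using dec[OF z, of k] by linarith
      then show "sqrt ((rdist (x (Suc k)) Z)\<^sup>2 + q * (r k)\<^sup>2) \<le> norm_wrt S (x k - z)"
        by (intro real_le_lsqrt) (simp_all add: norm_wrt_nonneg)
    qed
    then have "(rdist (x (Suc k)) Z)\<^sup>2 + q * (r k)\<^sup>2 \<le> (rdist (x k) Z)\<^sup>2"
      by (metis sqrt_le_D)
    moreover have "(rdist (x k) Z)\<^sup>2 \<le> (\<kappa> * r k)\<^sup>2"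
      using bound[OF k] rdist_nonneg[OF ne] by (intro power_mono)
    then have "q / \<kappa>\<^sup>2 * (rdist (x k) Z)\<^sup>2 \<le> q / \<kappa>\<^sup>2 * (\<kappa> * r k)\<^sup>2"
      using q \<kappa> by (intro mult_left_mono) auto
    then have "q / \<kappa>\<^sup>2 * (rdist (x k) Z)\<^sup>2 \<le> q * (r k)\<^sup>2"
      using \<kappa> by (simp add: power_mult_distrib)
    ultimately have "(rdist (x (Suc k)) Z)\<^sup>2 \<le> (1 - q / \<kappa>\<^sup>2) * (rdist (x k) Z)\<^sup>2"
      by (simp add: algebra_simps)
    also have "\<dots> \<le> max (1/2) (1 - q / \<kappa>\<^sup>2) * (rdist (x k) Z)\<^sup>2" by (intro mult_right_mono) auto
    also have "\<dots> = (c * rdist (x k) Z)\<^sup>2" by (simp add: c_def power_mult_distrib)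
    finally show ?thesis
      by (rule power2_le_imp_le) (use c rdist_nonneg[OF ne] in simp)
  qed
  have power: "rdist (x (K0 + j)) Z \<le> c ^ j * rdist (x K0) Z" for j
  proof (induction j)
    case (Suc j)
    have "rdist (x (K0 + Suc j)) Z \<le> c * rdist (x (K0 + j)) Z" using step[of "K0 + j"] by simp
    also have "\<dots> \<le> c * (c ^ j * rdist (x K0) Z)" using Suc c by (intro mult_left_mono) auto
    finally show ?case by simp
  qed simp
  have fejer: "norm_wrt S (x (Suc k) - z) \<le> norm_wrt S (x k - z)" if "z \<in> Z" for z k
  proof (rule power2_le_imp_le)
    have "0 \<le> q * (r k)\<^sup>2" using q by simp
    then show "(norm_wrt S (x (Suc k) - z))\<^sup>2 \<le> (norm_wrt S (x k - z))\<^sup>2" using dec[OF that, of k] by linarith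
  qed (rule norm_wrt_nonneg)
  have "norm_wrt S (x k - xb) \<le> 2 * rdist (x K0) Z / c ^ K0 * c ^ k" if "K0 \<le> k" for k
  proof -
    have "c ^ k = c ^ K0 * c ^ (k - K0)" using that by (simp flip: power_add)
    then have "2 * rdist (x K0) Z / c ^ K0 * c ^ k = 2 * (c ^ (k - K0) * rdist (x K0) Z)" using c by simp
    then show ?thesis
      using fejer_limit_le_rdist[of Z x, OF fejer ne lim, of k] power[of "k - K0"] that by simp
  qed
  moreover have "0 \<le> 2 * rdist (x K0) Z / c ^ K0" using rdist_nonneg[OF ne] c by simp
  ultimately have "locally_R_linear S x xb"
    unfolding locally_R_linear_def using c less_imp_le by blast
  moreover have "dist_wrt S (x (Suc k)) Z \<le> ennreal c * dist_wrt S (x k) Z" if "K0 \<le> k" for k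
    unfolding dist_wrt_eq_rdist[OF ne] using step[OF that] c rdist_nonneg[OF ne]
    by (simp add: ennreal_leI flip: ennreal_mult)
  then have "locally_Q_linear_to_zero (\<lambda>k. dist_wrt S (x k) Z)"
    unfolding locally_Q_linear_to_zero_def using c less_imp_le by blast
  ultimately show ?thesis by blast
qed

end

section \<open>From vanishing residuals to weak and linear convergence\<close>

context splitting
begin

text \<open>For late \<open>k\<close> the pair \<open>(xh k, u k)\<close> has entered both
  neighborhoods, and \<open>u k\<close> is an admissible competitor in the distance from 0 to
  \<open>F (xh k) \<inter> V\<close>.\<close>

lemma F_subregular_residual_bound:
  assumes sub: "metrically_subregular S F xb 0"
    and xh: "xh \<longlonglongrightarrow> xb" and u: "u \<longlonglongrightarrow> 0" and mem: "\<And>k. u k \<in> F (xh k)"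
  obtains \<kappa> K0 where "0 \<le> \<kappa>" "\<And>k. K0 \<le> k \<Longrightarrow> rdist (xh k) (zer F) \<le> \<kappa> * norm_wrt S (u k)"
proof -
  obtain \<kappa> U V where \<kappa>: "0 \<le> \<kappa>" and U: "xb \<in> interior U" and V: "0 \<in> interior V"
    and le: "\<And>x. x \<in> U \<Longrightarrow> dist_wrt S x (op_inverse F 0) \<le> ennreal \<kappa> * dist_wrt S 0 (F x \<inter> V)"
    and xb: "0 \<in> F xb"
    using sub unfolding metrically_subregular_def by blast
  have inv: "op_inverse F 0 = zer F" unfolding op_inverse_def zer_def by simp
  have ne: "zer F \<noteq> {}" using xb unfolding zer_def by blast
  have "\<forall>\<^sub>F k in sequentially. xh k \<in> interior U \<and> u k \<in> interior V"
    using topological_tendstoD[OF xh open_interior U] topological_tendstoD[OF u open_interior V]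
    by (rule eventually_conj)
  then obtain K0 where K0: "\<And>k. K0 \<le> k \<Longrightarrow> xh k \<in> U" "\<And>k. K0 \<le> k \<Longrightarrow> u k \<in> V"
    unfolding eventually_sequentially using interior_subset by blast
  have "rdist (xh k) (zer F) \<le> \<kappa> * norm_wrt S (u k)" if k: "K0 \<le> k" for k
  proof -
    have "ennreal (rdist (xh k) (zer F)) \<le> ennreal \<kappa> * dist_wrt S 0 (F (xh k) \<inter> V)"
      using le[OF K0(1)[OF k]] unfolding inv dist_wrt_eq_rdist[OF ne] .
    also have "dist_wrt S 0 (F (xh k) \<inter> V) \<le> ennreal (norm_wrt S (0 - u k))"
      unfolding dist_wrt_def using mem[of k] K0(2)[OF k] by (intro INF_lower) blast
    then have "ennreal \<kappa> * dist_wrt S 0 (F (xh k) \<inter> V) \<le> ennreal \<kappa> * ennreal (norm_wrt S (0 - u k))"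
      by (rule mult_left_mono) simp
    also have "\<dots> = ennreal (\<kappa> * norm_wrt S (u k))"
      using \<kappa> by (simp add: ennreal_mult norm_wrt_nonneg norm_wrt_minus)
    finally show ?thesis
      using \<kappa> by (subst (asm) ennreal_le_iff) (auto simp: norm_wrt_nonneg)
  qed
  with \<kappa> show ?thesis by (rule that)
qed

lemma residual_sequence_convergence:
  fixes x xh w :: "nat \<Rightarrow> 'a"
  assumes ne: "zer F \<noteq> {}" and q: "0 < q" and C: "0 < C"
    and w_le: "\<And>k. norm (w k) \<le> C * norm (x k - xh k)"
    and mem: "\<And>k. w k - (E (x k) - E (xh k)) \<in> F (xh k)"
    and dec: "\<And>z k. z \<in> zer F \<Longrightarrow>
      (norm_wrt S (x (Suc k) - z))\<^sup>2 \<le> (norm_wrt S (x k - z))\<^sup>2 - q * (norm (x k - xh k))\<^sup>2"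
  shows "\<exists>xb\<in>zer F. weakly_converges x xb \<and>
           ((\<forall>z\<in>zer F. metrically_subregular S F z 0) \<and> (\<exists>b::'a set. finite b \<and> span b = UNIV) \<longrightarrow>
              locally_R_linear S x xb \<and>
              locally_Q_linear_to_zero (\<lambda>k. dist_wrt S (x k) (zer F)))"
proof -
  define d where "d k = x k - xh k" for k
  define u where "u k = w k - (E (x k) - E (xh k))" for k
  have fejer: "norm_wrt S (x (Suc k) - z) \<le> norm_wrt S (x k - z)" if "z \<in> zer F" for z k
  proof (rule power2_le_imp_le)
    have "0 \<le> q * (norm (x k - xh k))\<^sup>2" using q by simp
    then show "(norm_wrt S (x (Suc k) - z))\<^sup>2 \<le> (norm_wrt S (x k - z))\<^sup>2" using dec[OF that, of k] by linarith
  qed (rule norm_wrt_nonneg)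
  obtain z0 where z0: "z0 \<in> zer F" using ne by blast
  \<comment> \<open>The squared residual is at most \<open>1 / q\<close> times the difference of
    consecutive squared distances to \<open>z0\<close>, and these distances converge.\<close>
  have d0: "d \<longlonglongrightarrow> 0"
  proof -
    obtain a where a: "(\<lambda>k. norm_wrt S (x k - z0)) \<longlonglongrightarrow> a"
      using fejer_convergent fejer[OF z0] unfolding convergent_def by blast
    have "(\<lambda>k. ((norm_wrt S (x k - z0))\<^sup>2 - (norm_wrt S (x (Suc k) - z0))\<^sup>2) / q) \<longlonglongrightarrow> (a\<^sup>2 - a\<^sup>2) / q"
      using q LIMSEQ_Suc[OF a] by (intro tendsto_intros a) auto
    then have "(\<lambda>k. ((norm_wrt S (x k - z0))\<^sup>2 - (norm_wrt S (x (Suc k) - z0))\<^sup>2) / q) \<longlonglongrightarrow> 0" by simp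
    moreover have "norm ((norm (d k))\<^sup>2) \<le> ((norm_wrt S (x k - z0))\<^sup>2 - (norm_wrt S (x (Suc k) - z0))\<^sup>2) / q" for k
      using dec[OF z0, of k] q by (simp add: d_def field_simps)
    ultimately have "(\<lambda>k. (norm (d k))\<^sup>2) \<longlonglongrightarrow> 0"
      by (intro Lim_null_comparison[of "\<lambda>k. (norm (d k))\<^sup>2"]) auto
    then have "(\<lambda>k. sqrt ((norm (d k))\<^sup>2)) \<longlonglongrightarrow> sqrt 0" by (rule tendsto_real_sqrt)
    then show ?thesis by (simp add: tendsto_norm_zero_iff)
  qed
  have u_le: "norm (u k) \<le> (C + \<beta>) * norm (d k)" for k
    using norm_triangle_ineq4[of "w k" "E (x k) - E (xh k)"] w_le[of k] E_lipschitz[of "x k" "xh k"]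
    unfolding u_def d_def by (simp add: algebra_simps)
  have u0: "u \<longlonglongrightarrow> 0"
  proof (rule Lim_null_comparison)
    show "\<forall>\<^sub>F k in sequentially. norm (u k) \<le> (C + \<beta>) * norm (d k)" using u_le by simp
    show "(\<lambda>k. (C + \<beta>) * norm (d k)) \<longlonglongrightarrow> 0"
      using tendsto_mult_right_zero[OF tendsto_norm_zero[OF d0]] by simp
  qed
  have "bounded (range x)" using fejer_bounded fejer[OF z0] by blast
  moreover have "bounded (range d)" using convergent_imp_bounded[OF d0] .
  moreover have xh_eq: "xh k = x k - d k" for k by (simp add: d_def)
  ultimately obtain R where R: "\<And>k. norm (x k) \<le> R" "\<And>k. norm (d k) \<le> R"
    unfolding bounded_iff by (meson max.coboundedI1 max.coboundedI2 rangeI)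
  have cluster: "xb \<in> zer F" if r: "strict_mono r" and xb: "hull_cluster (x \<circ> r) xb" for r xb
  proof (rule zer_F_memI)
    fix y v assume v: "v \<in> F y"
    \<comment> \<open>Monotonicity of \<open>F\<close> at \<open>xh k\<close> and \<open>y\<close>
      bounds \<open>inner (x k) v\<close> by \<open>inner y v\<close> plus this vanishing error.
      Such half-space bounds survive at hull cluster points.\<close>
    define err where "err k = inner (d k) v + (R + R + norm y) * norm (u k)" for k
    have "(\<lambda>k. inner (d k) v + (R + R + norm y) * norm (u k)) \<longlonglongrightarrow> inner 0 v + (R + R + norm y) * 0"
      by (intro tendsto_intros d0 tendsto_norm_zero u0)
    then have err: "err \<longlonglongrightarrow> 0" unfolding err_def by simp
    have le: "inner (x k) v \<le> inner y v + err k" for k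
    proof -
      have "0 \<le> inner (u k - v) (xh k - y)" using mem v unfolding u_def by (rule F_mono)
      then have "inner (x k) v \<le> inner y v + inner (d k) v + inner (u k) (xh k - y)"
        unfolding xh_eq by (simp add: inner_simps inner_commute)
      also have "inner (u k) (xh k - y) \<le> norm (u k) * norm (xh k - y)" by (rule norm_cauchy_schwarz)
      also have "norm (xh k - y) \<le> R + R + norm y"
        using norm_triangle_ineq4[of "x k - d k" y] norm_triangle_ineq4[of "x k" "d k"] R[of k]
        unfolding xh_eq by linarith
      then have "norm (u k) * norm (xh k - y) \<le> norm (u k) * (R + R + norm y)"
        by (rule mult_left_mono) simp
      finally show ?thesis by (simp add: err_def algebra_simps)
    qed
    have "inner xb v \<le> inner y v"
    proof (rule field_le_epsilon)
      fix e :: real assume "0 < e"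
      have "\<forall>\<^sub>F k in sequentially. (err \<circ> r) k < e"
        using order_tendstoD(2)[OF LIMSEQ_subseq_LIMSEQ[OF err r] \<open>0 < e\<close>] .
      then have "\<forall>\<^sub>F k in sequentially. inner ((x \<circ> r) k) v \<le> inner y v + e"
        by (rule eventually_mono) (use le in \<open>fastforce intro: order_trans\<close>)
      then show "inner xb v \<le> inner y v + e" by (rule hull_cluster_inner_le[OF xb])
    qed
    then show "inner v xb \<le> inner v y" by (simp add: inner_commute)
  qed
  have "\<exists>xb\<in>zer F. weakly_converges x xb"
    by (rule opial[OF _ ne]) (fact fejer, fact cluster)
  then obtain xb where xb: "xb \<in> zer F" "weakly_converges x xb" by blast
  have "locally_R_linear S x xb \<and> locally_Q_linear_to_zero (\<lambda>k. dist_wrt S (x k) (zer F))"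
    if sub: "\<forall>z\<in>zer F. metrically_subregular S F z 0" and fin: "\<exists>b::'a set. finite b \<and> span b = UNIV"
  proof -
    have lim: "x \<longlonglongrightarrow> xb" using fin weakly_converges_imp_tendsto[OF xb(2)] by blast
    have "xh \<longlonglongrightarrow> xb" using tendsto_diff[OF lim d0] by (simp add: d_def)
    then obtain \<kappa> K0 where \<kappa>: "0 \<le> \<kappa>"
      and K0: "\<And>k. K0 \<le> k \<Longrightarrow> rdist (xh k) (zer F) \<le> \<kappa> * norm_wrt S (u k)"
      using F_subregular_residual_bound[OF bspec[OF sub xb(1)] _ u0] mem unfolding u_def by blast
    obtain m n where n: "0 < n" "\<And>y. norm_wrt S y \<le> n * norm y" using norm_wrt_equiv by metis
    \<comment> \<open>Passing from \<open>x k\<close> to \<open>xh k\<close> costs the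
      \<open>S\<close>-norm of \<open>d k\<close>; subregularity bounds the rest by
      \<open>u k\<close>, which is itself controlled by \<open>d k\<close>.\<close>
    have "rdist (x k) (zer F) \<le> (n + \<kappa> * (n * (C + \<beta>))) * norm (x k - xh k)" if k: "K0 \<le> k" for k
    proof -
      have "rdist (x k) (zer F) \<le> norm_wrt S (d k) + rdist (xh k) (zer F)"
        unfolding d_def by (rule rdist_triangle[OF ne])
      also have "\<dots> \<le> n * norm (d k) + \<kappa> * norm_wrt S (u k)"
        using n(2)[of "d k"] K0[OF k] by linarith
      also have "norm_wrt S (u k) \<le> n * ((C + \<beta>) * norm (d k))"
        using n(2)[of "u k"] mult_left_mono[OF u_le[of k], of n] n(1) by linarith
      then have "\<kappa> * norm_wrt S (u k) \<le> \<kappa> * (n * ((C + \<beta>) * norm (d k)))"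
        using \<kappa> by (rule mult_left_mono)
      finally show ?thesis unfolding d_def by (simp add: algebra_simps)
    qed
    moreover have "0 < n + \<kappa> * (n * (C + \<beta>))" using n \<kappa> C \<beta> by (simp add: add_pos_nonneg)
    ultimately show ?thesis
      by (intro fejer_error_bound_linear_rate[of "zer F" x q "\<lambda>k. norm (x k - xh k)", OF dec ne q lim norm_ge_zero])
  qed
  then show ?thesis using xb by blast
qed

end

theorem theorem4:
  fixes S D E K :: "'a::{real_inner, complete_space} \<Rightarrow> 'a"
    and B F :: "'a \<Rightarrow> 'a set"
    and L_D \<beta>_E \<epsilon> \<epsilon>_\<theta> :: real
    and \<theta> \<gamma> \<mu> :: "nat \<Rightarrow> real"
    and M :: "nat \<Rightarrow> 'a \<Rightarrow> 'a"
    and x xhat :: "nat \<Rightarrow> 'a"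
  assumes S: "pos_def_op S"
    and L_D: "0 \<le> L_D"
    and \<beta>_E: "0 \<le> \<beta>_E"
    and D: "lipschitz_on L_D UNIV D"
    and E: "recip_cocoercive \<beta>_E E"
    and K: "linear_skew_adjoint K"
    and BD: "maximally_monotone (\<lambda>z. B z + {D z})"
    and F: "F = (\<lambda>z. B z + {D z} + {E z} + {K z})"
    and zer: "zer F \<noteq> {}"
    and \<epsilon>_\<theta>: "0 < \<epsilon>_\<theta>" "\<epsilon>_\<theta> < 1"
    and \<theta>: "\<And>k. \<epsilon>_\<theta> \<le> \<theta> k \<and> \<theta> k \<le> 2 - \<epsilon>_\<theta>"
    and \<epsilon>: "0 < \<epsilon>" "\<epsilon> < 1"
    and \<gamma>: "\<And>k. \<epsilon> \<le> \<gamma> k \<and> \<gamma> k \<le> 1 / \<epsilon>"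
    and \<gamma>_bound: "\<And>k. \<beta>_E + 4 * L_D \<noteq> 0 \<Longrightarrow> \<gamma> k \<le> (4 - \<epsilon>) / (\<beta>_E + 4 * L_D)"
    and M: "\<And>k z. M k z = inverse (\<gamma> k) *\<^sub>R z - D z - K z"
    and xhat: "\<And>k. xhat k =
          the_elem (op_inverse (\<lambda>z. {z} + (\<lambda>u. \<gamma> k *\<^sub>R u) ` B z)
            (x k - \<gamma> k *\<^sub>R (D (x k) + K (x k) + E (x k))))"
    and \<mu>: "\<And>k. \<mu> k =
          (inner (M k (x k) - M k (xhat k)) (x k - xhat k) - \<beta>_E / 4 * (norm (x k - xhat k))\<^sup>2)
          / (norm_wrt (inv S) (M k (x k) - M k (xhat k)))\<^sup>2"
    and x: "\<And>k. x (Suc k) =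
          x k - (\<theta> k * \<mu> k) *\<^sub>R inv S (M k (x k) - M k (xhat k))"
  shows "\<exists>xb\<in>zer F. weakly_converges x xb \<and>
           ((\<forall>z\<in>zer F. metrically_subregular S F z 0) \<and> (\<exists>b::'a set. finite b \<and> span b = UNIV) \<longrightarrow>
              locally_R_linear S x xb \<and>
              locally_Q_linear_to_zero (\<lambda>k. dist_wrt S (x k) (zer F)))"
proof -
  interpret splitting S B D E K L_D \<beta>_E
    by unfold_locales (fact S L_D \<beta>_E D E K BD)+
  obtain C q where Cq: "0 < C" "0 < q"
    and step: "\<And>\<gamma> \<theta> \<mu> x xh w. \<epsilon> \<le> \<gamma> \<Longrightarrow> \<gamma> \<le> 1 / \<epsilon>
      \<Longrightarrow> (\<beta>_E + 4 * L_D \<noteq> 0 \<Longrightarrow> \<gamma> \<le> (4 - \<epsilon>) / (\<beta>_E + 4 * L_D))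
      \<Longrightarrow> \<epsilon>_\<theta> \<le> \<theta> \<Longrightarrow> \<theta> \<le> 2 - \<epsilon>_\<theta>
      \<Longrightarrow> xh = the_elem (op_inverse (\<lambda>z. {z} + (\<lambda>u. \<gamma> *\<^sub>R u) ` B z) (x - \<gamma> *\<^sub>R (D x + K x + E x)))
      \<Longrightarrow> w = (inverse \<gamma> *\<^sub>R x - D x - K x) - (inverse \<gamma> *\<^sub>R xh - D xh - K xh)
      \<Longrightarrow> \<mu> = (inner w (x - xh) - \<beta>_E / 4 * (norm (x - xh))\<^sup>2) / (norm_wrt (inv S) w)\<^sup>2
      \<Longrightarrow> norm w \<le> C * norm (x - xh) \<and> w - (E x - E xh) \<in> B xh + {D xh} + {E xh} + {K xh}
        \<and> (\<forall>z\<in>zer (\<lambda>z. B z + {D z} + {E z} + {K z}).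
            (norm_wrt S (x - (\<theta> * \<mu>) *\<^sub>R inv S w - z))\<^sup>2
              \<le> (norm_wrt S (x - z))\<^sup>2 - q * (norm (x - xh))\<^sup>2)"
    using iteration_step[OF \<epsilon> \<epsilon>_\<theta>(1)] by blast
  define w where "w k = M k (x k) - M k (xhat k)" for k
  have *: "norm (w k) \<le> C * norm (x k - xhat k)
      \<and> w k - (E (x k) - E (xhat k)) \<in> B (xhat k) + {D (xhat k)} + {E (xhat k)} + {K (xhat k)}
      \<and> (\<forall>z\<in>zer F. (norm_wrt S (x (Suc k) - z))\<^sup>2
            \<le> (norm_wrt S (x k - z))\<^sup>2 - q * (norm (x k - xhat k))\<^sup>2)" for k
    unfolding x[of k] F w_def
    using \<gamma>[of k] \<theta>[of k] \<gamma>_bound[of k] by (intro step[of "\<gamma> k"] xhat \<mu>) (auto simp: M)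
  show ?thesis
    unfolding F
    by (rule residual_sequence_convergence[OF zer[unfolded F] Cq(2,1), of w x xhat]) (use * F in auto)
qed

end
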